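(* Let $k$ be a commutative ring and $\mathcal{A}$ a unital associative $k$-algebra with center $Z(\mathcal{A})$. Then for all $e_1,e_2,e_3\in E(\mathcal{A})$ and $z\in Z(\mathcal{A})$ the Courant bracket satisfies (1) $[\![e_1,[\![e_2,e_3]\!]]\!]=[\![[\![e_1,e_2]\!],e_3]\!]+[\![e_2,[\![e_1,e_3]\!]]\!]$; (2) $\rho[\![e_1,e_2]\!]=[\rho(e_1),\rho(e_2)]$; (3) $[\![e_1,ze_2]\!]=z[\![e_1,e_2]\!]+\rho(e_1)(z)\,e_2$; (4) $2[\![e_1,e_1]\!]=D(e_1,e_1)$; (5) $\mathcal{L}_{\rho(e_1)}(e_2,e_3)=([\![e_1,e_2]\!],e_3)+(e_2,[\![e_1,e_3]\!])$. Here $D:H_0(\mathcal{A},\mathcal{A})\to E(\mathcal{A})$ is the $k$-homomorphism $D(\alpha)=(0,B(\alpha))$.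
   Context: Let $C_n(\mathcal{A},\mathcal{A})=\mathcal{A}\otimes_k\mathcal{A}^{\otimes n}$ with Hochschild boundary $b(a_0\otimes\dots\otimes a_n)=\sum_{i=0}^{n-1}(-1)^i a_0\otimes\dots\otimes a_ia_{i+1}\otimes\dots\otimes a_n+(-1)^n a_na_0\otimes a_1\otimes\dots\otimes a_{n-1}$, and let $H_n(\mathcal{A},\mathcal{A})$ be its homology; in particular $H_0(\mathcal{A},\mathcal{A})=\mathcal{A}/[\mathcal{A},\mathcal{A}]$. Let $H^1(\mathcal{A},\mathcal{A})=\mathrm{Der}_k(\mathcal{A})/\{[a,\cdot]:a\in\mathcal{A}\}$ (derivations modulo inner derivations), with the Lie bracket induced by the commutator. The center $Z(\mathcal{A})$ acts on $H_n$ by $z(a_0\otimes\dots\otimes a_n)=za_0\otimes\dots\otimes a_n$ and on $H^1$ by $(zX)(a)=zX(a)$. There is a well-defined action $H^1(\mathcal{A},\mathcal{A})\times Z(\mathcal{A})\to Z(\mathcal{A})$, $(X,z)\mapsto X(z)$. For $X\in H^1(\mathcal{A},\mathcal{A})$, represented by a derivation again denoted $X$, the following operations, given on the level of chains, are well defined on homology: the Lie derivative $\mathcal{L}_X(a_0\otimes\dots\otimes a_n)=\sum_{i=0}^n a_0\otimes\dots\otimes X(a_i)\otimes\dots\otimes a_n$ on $H_n$ (so $\mathcal{L}_X a=X(a)$ on $H_0$); the interior product $i_X:H_1(\mathcal{A},\mathcal{A})\to H_0(\mathcal{A},\mathcal{A})$, $i_X(a_0\otimes a_1)=X(a_1)a_0$;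 and Connes' map $B:H_0(\mathcal{A},\mathcal{A})\to H_1(\mathcal{A},\mathcal{A})$, $B(a)=1\otimes a+a\otimes1$ (homologous to $1\otimes a$). The pairing is $\langle X,\alpha\rangle:=i_X\alpha\in H_0(\mathcal{A},\mathcal{A})$. Let $E(\mathcal{A}):=H^1(\mathcal{A},\mathcal{A})\oplus H_1(\mathcal{A},\mathcal{A})$. The Courant bracket is $[\![(X_1,\alpha_1),(X_2,\alpha_2)]\!]=([X_1,X_2],\ \mathcal{L}_{X_1}\alpha_2-\mathcal{L}_{X_2}\alpha_1+B\langle X_2,\alpha_1\rangle)$; the $H_0(\mathcal{A},\mathcal{A})$-valued symmetric bilinear form is $((X_1,\alpha_1),(X_2,\alpha_2))=\langle X_2,\alpha_1\rangle+\langle X_1,\alpha_2\rangle$; and $\rho:E(\mathcal{A})\to H^1(\mathcal{A},\mathcal{A})$ is the projection $\rho(X,\alpha)=X$. In (4), $D(e_1,e_1)$ means $D$ applied to the value $(e_1,e_1)\in H_0(\mathcal{A},\mathcal{A})$ of the bilinear form. *)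

theory Defs
  imports
    "HOL-Library.Poly_Mapping"
    "HOL-Library.Set_Algebras"
    "HOL-Library.Function_Algebras"
    "HOL-Library.Product_Plus"
begin

section \<open>Algebras over a commutative ring\<close>

text \<open>The sorts \<open>{comm_ring, comm_monoid_mult}\<close> and \<open>{ring, monoid_mult}\<close> describe unital
  commutative, respectively associative, rings without the axiom \<open>0 \<noteq> 1\<close> contained in
  \<open>comm_ring_1\<close> and \<open>ring_1\<close>, so that zero rings are included.\<close>

locale k_algebra =
  fixes s :: "'k::{comm_ring,comm_monoid_mult} \<Rightarrow> 'a::{ring,monoid_mult} \<Rightarrow> 'a"
  assumes scale_add_right: "s r (x + y) = s r x + s r y"
    and scale_add_left: "s (r + t) x = s r x + s t x"
    and scale_scale: "s r (s t x) = s (r * t) x"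
    and scale_one: "s 1 x = x"
    and scale_mult_left: "s r x * y = s r (x * y)"
    and scale_mult_right: "x * s r y = s r (x * y)"

definition center :: "'a::times set" where
  "center = {z. \<forall>a. z * a = a * z}"

section \<open>Quotients\<close>

text \<open>Elements of a quotient \<open>V/N\<close> are the cosets \<open>v +o N\<close>, which are sets. Their sum in
  \<open>V/N\<close> is the elementwise sum \<open>+\<close> of sets. Note that \<open>-\<close> is set difference on sets and
  \<open>0\<close> is \<open>{0}\<close>; neither is used for quotients (the zero of \<open>V/N\<close> is \<open>N\<close>).

  If \<open>f\<close> maps \<open>V\<close> to \<open>W\<close> and is compatible with the subgroups, the union below consists of
  equal cosets: it is the induced map \<open>v + N' \<mapsto> f v + N\<close> from \<open>V/N'\<close> to \<open>W/N\<close>. The same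
  device is used whenever an operation is given on representatives.\<close>

definition induced :: "'w::plus set \<Rightarrow> ('v \<Rightarrow> 'w) \<Rightarrow> 'v set \<Rightarrow> 'w set" where
  "induced N f c = (\<Union>v\<in>c. f v +o N)"

section \<open>Tensor powers\<close>

text \<open>The list \<open>[a\<^sub>0, \<dots>, a\<^sub>n]\<close> stands for \<open>a\<^sub>0 \<otimes> \<dots> \<otimes> a\<^sub>n\<close>. The tensor power is the free
  \<open>k\<close>-module on lists of length \<open>n + 1\<close> modulo the relations of multilinearity.\<close>

type_synonym ('a, 'k) free_chain = "'a list \<Rightarrow>\<^sub>0 'k"
type_synonym ('a, 'k) chain = "('a, 'k) free_chain set"
type_synonym ('a, 'k) homology_class = "('a, 'k) chain set"

abbreviation gen :: "'a list \<Rightarrow> ('a, 'k::{comm_ring,comm_monoid_mult}) free_chain" where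
  "gen xs \<equiv> Poly_Mapping.single xs 1"

definition free_scale ::
  "'k::{comm_ring,comm_monoid_mult} \<Rightarrow> ('a, 'k) free_chain \<Rightarrow> ('a, 'k) free_chain" where
  "free_scale r f = Poly_Mapping.map ((*) r) f"

definition lin_ext ::
  "('a list \<Rightarrow> ('a, 'k::{comm_ring,comm_monoid_mult}) free_chain) \<Rightarrow>
   ('a, 'k) free_chain \<Rightarrow> ('a, 'k) free_chain" where
  "lin_ext g f = (\<Sum>xs\<in>Poly_Mapping.keys f. free_scale (Poly_Mapping.lookup f xs) (g xs))"

inductive_set tensor_rel ::
  "('k::{comm_ring,comm_monoid_mult} \<Rightarrow> 'a::{ring,monoid_mult} \<Rightarrow> 'a) \<Rightarrow> nat \<Rightarrow>
   ('a, 'k) free_chain set"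
  for s :: "'k::{comm_ring,comm_monoid_mult} \<Rightarrow> 'a::{ring,monoid_mult} \<Rightarrow> 'a" and n :: nat
where
  additive: "length xs = Suc n \<Longrightarrow> i \<le> n \<Longrightarrow>
    gen (xs[i := x + y]) - gen (xs[i := x]) - gen (xs[i := y]) \<in> tensor_rel s n"
| homogeneous: "length xs = Suc n \<Longrightarrow> i \<le> n \<Longrightarrow>
    gen (xs[i := s r x]) - free_scale r (gen (xs[i := x])) \<in> tensor_rel s n"
| zero: "0 \<in> tensor_rel s n"
| add: "f \<in> tensor_rel s n \<Longrightarrow> g \<in> tensor_rel s n \<Longrightarrow> f + g \<in> tensor_rel s n"
| scale: "f \<in> tensor_rel s n \<Longrightarrow> free_scale r f \<in> tensor_rel s n"

definition C ::
  "('k::{comm_ring,comm_monoid_mult} \<Rightarrow> 'a::{ring,monoid_mult} \<Rightarrow> 'a) \<Rightarrow> nat \<Rightarrow>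
   ('a, 'k) chain set" where
  "C s n = {f +o tensor_rel s n | f. \<forall>xs\<in>Poly_Mapping.keys f. length xs = Suc n}"

definition chain_map ::
  "('k::{comm_ring,comm_monoid_mult} \<Rightarrow> 'a::{ring,monoid_mult} \<Rightarrow> 'a) \<Rightarrow> nat \<Rightarrow>
   ('a list \<Rightarrow> ('a, 'k) free_chain) \<Rightarrow> ('a, 'k) chain \<Rightarrow> ('a, 'k) chain" where
  "chain_map s n g = induced (tensor_rel s n) (lin_ext g)"

section \<open>Hochschild homology\<close>

text \<open>\<open>hochschild_b s n\<close> is the boundary from \<open>C s (Suc n)\<close> to \<open>C s n\<close>; its formula
  \<open>b_gen\<close> is for lists \<open>[a\<^sub>0, \<dots>, a\<^sub>m]\<close> with \<open>m = Suc n\<close>.\<close>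

definition b_gen ::
  "nat \<Rightarrow> 'a::{ring,monoid_mult} list \<Rightarrow> ('a, 'k::{comm_ring,comm_monoid_mult}) free_chain" where
  "b_gen m xs =
     (\<Sum>i<m. Poly_Mapping.single
        (take i xs @ [xs ! i * xs ! Suc i] @ drop (Suc (Suc i)) xs) ((- 1) ^ i))
     + Poly_Mapping.single ((xs ! m * xs ! 0) # tl (butlast xs)) ((- 1) ^ m)"

definition hochschild_b ::
  "('k::{comm_ring,comm_monoid_mult} \<Rightarrow> 'a::{ring,monoid_mult} \<Rightarrow> 'a) \<Rightarrow> nat \<Rightarrow>
   ('a, 'k) chain \<Rightarrow> ('a, 'k) chain" where
  "hochschild_b s n = chain_map s n (b_gen (Suc n))"

definition cycles ::
  "('k::{comm_ring,comm_monoid_mult} \<Rightarrow> 'a::{ring,monoid_mult} \<Rightarrow> 'a) \<Rightarrow> nat \<Rightarrow>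
   ('a, 'k) chain set" where
  "cycles s n = (case n of 0 \<Rightarrow> C s 0
     | Suc m \<Rightarrow> {c \<in> C s (Suc m). hochschild_b s m c = tensor_rel s m})"

definition boundaries ::
  "('k::{comm_ring,comm_monoid_mult} \<Rightarrow> 'a::{ring,monoid_mult} \<Rightarrow> 'a) \<Rightarrow> nat \<Rightarrow>
   ('a, 'k) chain set" where
  "boundaries s n = hochschild_b s n ` C s (Suc n)"

definition HH ::
  "('k::{comm_ring,comm_monoid_mult} \<Rightarrow> 'a::{ring,monoid_mult} \<Rightarrow> 'a) \<Rightarrow> nat \<Rightarrow>
   ('a, 'k) homology_class set" where
  "HH s n = {c +o boundaries s n | c. c \<in> cycles s n}"

definition HH_scale ::
  "('k::{comm_ring,comm_monoid_mult} \<Rightarrow> 'a::{ring,monoid_mult} \<Rightarrow> 'a) \<Rightarrow> nat \<Rightarrow>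
   'k \<Rightarrow> ('a, 'k) homology_class \<Rightarrow> ('a, 'k) homology_class" where
  "HH_scale s n r = induced (boundaries s n) (induced (tensor_rel s n) (free_scale r))"

definition HH_minus ::
  "('k::{comm_ring,comm_monoid_mult} \<Rightarrow> 'a::{ring,monoid_mult} \<Rightarrow> 'a) \<Rightarrow> nat \<Rightarrow>
   ('a, 'k) homology_class \<Rightarrow> ('a, 'k) homology_class \<Rightarrow> ('a, 'k) homology_class" where
  "HH_minus s n \<alpha> \<beta> = \<alpha> + HH_scale s n (- 1) \<beta>"

definition HH_center_mult ::
  "('k::{comm_ring,comm_monoid_mult} \<Rightarrow> 'a::{ring,monoid_mult} \<Rightarrow> 'a) \<Rightarrow> nat \<Rightarrow>
   'a \<Rightarrow> ('a, 'k) homology_class \<Rightarrow> ('a, 'k) homology_class" where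
  "HH_center_mult s n z =
     induced (boundaries s n) (chain_map s n (\<lambda>xs. gen ((z * hd xs) # tl xs)))"

section \<open>Outer derivations\<close>

definition Der ::
  "('k::{comm_ring,comm_monoid_mult} \<Rightarrow> 'a::{ring,monoid_mult} \<Rightarrow> 'a) \<Rightarrow> ('a \<Rightarrow> 'a) set" where
  "Der s = {x. (\<forall>a b. x (a + b) = x a + x b) \<and> (\<forall>r a. x (s r a) = s r (x a)) \<and>
               (\<forall>a b. x (a * b) = x a * b + a * x b)}"

definition Inn :: "('a::{ring,monoid_mult} \<Rightarrow> 'a) set" where
  "Inn = range (\<lambda>a b. a * b - b * a)"

definition H1 ::
  "('k::{comm_ring,comm_monoid_mult} \<Rightarrow> 'a::{ring,monoid_mult} \<Rightarrow> 'a) \<Rightarrow> ('a \<Rightarrow> 'a) set set" where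
  "H1 s = {x +o Inn | x. x \<in> Der s}"

definition H1_scale ::
  "('k::{comm_ring,comm_monoid_mult} \<Rightarrow> 'a::{ring,monoid_mult} \<Rightarrow> 'a) \<Rightarrow>
   'k \<Rightarrow> ('a \<Rightarrow> 'a) set \<Rightarrow> ('a \<Rightarrow> 'a) set" where
  "H1_scale s r = induced Inn (\<lambda>x a. s r (x a))"

definition H1_center_mult ::
  "'a::{ring,monoid_mult} \<Rightarrow> ('a \<Rightarrow> 'a) set \<Rightarrow> ('a \<Rightarrow> 'a) set" where
  "H1_center_mult z = induced Inn (\<lambda>x a. z * x a)"

definition H1_bracket ::
  "('a::{ring,monoid_mult} \<Rightarrow> 'a) set \<Rightarrow> ('a \<Rightarrow> 'a) set \<Rightarrow> ('a \<Rightarrow> 'a) set" where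
  "H1_bracket X Y = (\<Union>x\<in>X. induced Inn (\<lambda>y a. x (y a) - y (x a)) Y)"

text \<open>The common value at a central element \<open>z\<close> of all derivations in the class \<open>X\<close>.\<close>

definition H1_apply :: "('a \<Rightarrow> 'a) set \<Rightarrow> 'a \<Rightarrow> 'a" where
  "H1_apply X z = (THE w. \<forall>x\<in>X. x z = w)"

section \<open>Cartan calculus\<close>

definition Lie ::
  "('k::{comm_ring,comm_monoid_mult} \<Rightarrow> 'a::{ring,monoid_mult} \<Rightarrow> 'a) \<Rightarrow> nat \<Rightarrow>
   ('a \<Rightarrow> 'a) set \<Rightarrow> ('a, 'k) homology_class \<Rightarrow> ('a, 'k) homology_class" where
  "Lie s n X \<alpha> = (\<Union>x\<in>X. induced (boundaries s n)
     (chain_map s n (\<lambda>xs. \<Sum>i\<le>n. gen (xs[i := x (xs ! i)]))) \<alpha>)"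

definition pairing ::
  "('k::{comm_ring,comm_monoid_mult} \<Rightarrow> 'a::{ring,monoid_mult} \<Rightarrow> 'a) \<Rightarrow>
   ('a \<Rightarrow> 'a) set \<Rightarrow> ('a, 'k) homology_class \<Rightarrow> ('a, 'k) homology_class" where
  "pairing s X \<alpha> = (\<Union>x\<in>X. induced (boundaries s 0)
     (chain_map s 0 (\<lambda>xs. gen [x (xs ! 1) * xs ! 0])) \<alpha>)"

definition Connes_B ::
  "('k::{comm_ring,comm_monoid_mult} \<Rightarrow> 'a::{ring,monoid_mult} \<Rightarrow> 'a) \<Rightarrow>
   ('a, 'k) homology_class \<Rightarrow> ('a, 'k) homology_class" where
  "Connes_B s = induced (boundaries s 1)
     (chain_map s 1 (\<lambda>xs. gen [1, xs ! 0] + gen [xs ! 0, 1]))"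

section \<open>The Courant bracket\<close>

type_synonym ('a, 'k) courant_elem = "('a \<Rightarrow> 'a) set \<times> ('a, 'k) homology_class"

text \<open>Sums in \<open>E\<close> are the componentwise sums \<open>+\<close> of pairs.\<close>

definition E ::
  "('k::{comm_ring,comm_monoid_mult} \<Rightarrow> 'a::{ring,monoid_mult} \<Rightarrow> 'a) \<Rightarrow>
   ('a, 'k) courant_elem set" where
  "E s = H1 s \<times> HH s 1"

definition E_scale ::
  "('k::{comm_ring,comm_monoid_mult} \<Rightarrow> 'a::{ring,monoid_mult} \<Rightarrow> 'a) \<Rightarrow>
   'k \<Rightarrow> ('a, 'k) courant_elem \<Rightarrow> ('a, 'k) courant_elem" where
  "E_scale s r e = (H1_scale s r (fst e), HH_scale s 1 r (snd e))"

definition E_center_mult ::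
  "('k::{comm_ring,comm_monoid_mult} \<Rightarrow> 'a::{ring,monoid_mult} \<Rightarrow> 'a) \<Rightarrow>
   'a \<Rightarrow> ('a, 'k) courant_elem \<Rightarrow> ('a, 'k) courant_elem" where
  "E_center_mult s z e = (H1_center_mult z (fst e), HH_center_mult s 1 z (snd e))"

definition courant ::
  "('k::{comm_ring,comm_monoid_mult} \<Rightarrow> 'a::{ring,monoid_mult} \<Rightarrow> 'a) \<Rightarrow>
   ('a, 'k) courant_elem \<Rightarrow> ('a, 'k) courant_elem \<Rightarrow> ('a, 'k) courant_elem" where
  "courant s e1 e2 = (case (e1, e2) of ((X1, \<alpha>1), (X2, \<alpha>2)) \<Rightarrow>
     (H1_bracket X1 X2,
      HH_minus s 1 (Lie s 1 X1 \<alpha>2) (Lie s 1 X2 \<alpha>1) + Connes_B s (pairing s X2 \<alpha>1)))"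

definition form ::
  "('k::{comm_ring,comm_monoid_mult} \<Rightarrow> 'a::{ring,monoid_mult} \<Rightarrow> 'a) \<Rightarrow>
   ('a, 'k) courant_elem \<Rightarrow> ('a, 'k) courant_elem \<Rightarrow> ('a, 'k) homology_class" where
  "form s e1 e2 = (case (e1, e2) of ((X1, \<alpha>1), (X2, \<alpha>2)) \<Rightarrow>
     pairing s X2 \<alpha>1 + pairing s X1 \<alpha>2)"

definition anchor :: "('a, 'k) courant_elem \<Rightarrow> ('a \<Rightarrow> 'a) set" where
  "anchor e = fst e"

text \<open>\<open>Inn\<close> is the zero of \<open>H1 s\<close>.\<close>

definition D ::
  "('k::{comm_ring,comm_monoid_mult} \<Rightarrow> 'a::{ring,monoid_mult} \<Rightarrow> 'a) \<Rightarrow>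
   ('a, 'k) homology_class \<Rightarrow> ('a, 'k) courant_elem" where
  "D s \<alpha> = (Inn, Connes_B s \<alpha>)"

end

theory Submission
  imports Defs
begin

text \<open>All operations are compatible with passing to homology, so everything can be computed with
  representatives: a derivation \<open>x\<close> for each class in \<open>H1 s\<close>, and for each homology class a
  formal combination of lists. Call a formal combination \<^emph>\<open>null\<close> if it is a boundary up to the
  relations of the tensor power. A homology class depends only on its representative modulo null
  chains (\<open>hclass_eqI\<close>), and formal combinations form a type with an abelian group structure,
  whereas the type of sets with elementwise addition is only a commutative monoid.

  The operations descend to homology for two reasons. Each of them is multilinear and sends
  boundaries to null chains. And replacing \<open>x\<close> by \<open>x + [c, \<cdot>]\<close> changes \<open>i\<^sub>x\<close> and \<open>L\<^sub>x\<close> on a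
  1-chain \<open>f\<close> by a null chain plus a linear function of the boundary of \<open>f\<close>, which vanishes for a
  cycle (\<open>lie_inner_1\<close>, \<open>pairing_inner\<close>).

  After that, the axioms of the Courant bracket are formal consequences of the following
  identities modulo null chains:
  \<^item> \<open>L\<^sub>[\<^sub>x\<^sub>,\<^sub>y\<^sub>] = [L\<^sub>x, L\<^sub>y]\<close> (\<open>lie_der_bracket\<close>),
  \<^item> \<open>L\<^sub>x i\<^sub>y = i\<^sub>[\<^sub>x\<^sub>,\<^sub>y\<^sub>] + i\<^sub>y L\<^sub>x\<close> (\<open>lie_pairing\<close>),
  \<^item> \<open>L\<^sub>x B = B L\<^sub>x\<close> and \<open>i\<^sub>x B = L\<^sub>x\<close> on degree zero (\<open>lie_connes\<close>, \<open>pairing_connes\<close>),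
  \<^item> \<open>L\<^sub>x z = z L\<^sub>x + x(z)\<close> for central \<open>z\<close> (\<open>lie_center\<close>),
  \<^item> \<open>L\<^sub>z\<^sub>x - B i\<^sub>z\<^sub>x = z (L\<^sub>x - B i\<^sub>x)\<close> for central \<open>z\<close> (\<open>lie_minus_connes_center\<close>).

  For commuting variables the last identity says that \<open>L\<^sub>x - B i\<^sub>x = i\<^sub>x B\<close> is linear in \<open>x\<close> over
  functions. Here it holds because both sides are represented by
  \<open>z x(a) \<otimes> b - z x(b) \<otimes> a\<close> on \<open>a \<otimes> b\<close>. Every identity is checked on elementary tensors, where it is an
  explicit combination of Hochschild boundaries of elementary tensors and multilinearity
  relations.\<close>

section \<open>Cosets\<close>

definition additive_subgroup :: "'v::ab_group_add set \<Rightarrow> bool" where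
  "additive_subgroup N \<longleftrightarrow> 0 \<in> N \<and> (\<forall>x\<in>N. \<forall>y\<in>N. x - y \<in> N)"

lemma additive_subgroup_closed:
  assumes "additive_subgroup N"
  shows "0 \<in> N"
    and "x \<in> N \<Longrightarrow> - x \<in> N"
    and "x \<in> N \<Longrightarrow> y \<in> N \<Longrightarrow> x + y \<in> N"
    and "x \<in> N \<Longrightarrow> y \<in> N \<Longrightarrow> x - y \<in> N"
proof -
  show zero: "0 \<in> N" and diff: "x \<in> N \<Longrightarrow> y \<in> N \<Longrightarrow> x - y \<in> N" for x y
    using assms by (auto simp: additive_subgroup_def)
  show uminus: "x \<in> N \<Longrightarrow> - x \<in> N" for x
    using diff[OF zero, of x] by simp
  show "x \<in> N \<Longrightarrow> y \<in> N \<Longrightarrow> x + y \<in> N"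
    using diff[of x "- y"] uminus[of y] by simp
qed

lemma mem_coset_iff: "v \<in> u +o N \<longleftrightarrow> v - u \<in> N" for u v :: "'v::ab_group_add"
  by (force simp: elt_set_plus_def)

lemma coset_eqI:
  assumes "additive_subgroup N" "u - v \<in> N"
  shows "u +o N = v +o N"
proof (rule set_eqI)
  fix w
  have "w - u \<in> N \<longleftrightarrow> w - v \<in> N"
    using additive_subgroup_closed(3)[OF assms(1) _ assms(2), of "w - u"]
      additive_subgroup_closed(4)[OF assms(1) _ assms(2), of "w - v"]
    by auto
  then show "w \<in> u +o N \<longleftrightarrow> w \<in> v +o N"
    by (simp add: mem_coset_iff)
qed

lemma coset_add:
  assumes "additive_subgroup N"
  shows "(u +o N) + (v +o N) = (u + v) +o N"
proof -
  have "N + N = N"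
    using additive_subgroup_closed(1,3)[OF assms] by (force simp: set_plus_def)
  then show ?thesis
    by (simp add: set_plus_rearranges add.commute)
qed

text \<open>The operations on classes are unions over representatives; this evaluates such a union once
  all representatives are known to give the same result.\<close>

lemma UN_coset:
  assumes "additive_subgroup N" "\<And>v. v - u \<in> N \<Longrightarrow> G v = c"
  shows "(\<Union>v\<in>u +o N. G v) = c"
proof -
  have "u \<in> u +o N"
    using assms(1) by (simp add: mem_coset_iff additive_subgroup_closed)
  then show ?thesis
    using assms(2) by (auto simp: mem_coset_iff)
qed

lemma induced_coset:
  assumes "additive_subgroup M" "additive_subgroup N"
    and "\<And>v. v - u \<in> M \<Longrightarrow> f v - f u \<in> N"
  shows "induced N f (u +o M) = f u +o N"
  unfolding induced_def
  using assms by (intro UN_coset coset_eqI)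

section \<open>Linear extension\<close>

lemma lookup_free_scale: "Poly_Mapping.lookup (free_scale r f) xs = r * Poly_Mapping.lookup f xs"
  by (simp add: free_scale_def Poly_Mapping.map.rep_eq when_def)

lemma free_scale_simps:
  "free_scale r (f + g) = free_scale r f + free_scale r g"
  "free_scale r (f - g) = free_scale r f - free_scale r g"
  "free_scale r (- f) = - free_scale r f"
  "free_scale (r + t) f = free_scale r f + free_scale t f"
  "free_scale r (free_scale t f) = free_scale (r * t) f"
  "free_scale 1 f = f"
  "free_scale 0 f = 0"
  "free_scale r 0 = 0"
  "free_scale (- r) f = - free_scale r f"
  by (auto intro!: poly_mapping_eqI
      simp: lookup_free_scale lookup_add lookup_minus algebra_simps)

lemma free_scale_sum: "free_scale r (sum F A) = (\<Sum>a\<in>A. free_scale r (F a))"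
  by (induction A rule: infinite_finite_induct) (simp_all add: free_scale_simps)

text \<open>Summing over a common finite set of lists makes additivity provable although keys may cancel.\<close>

lemma lin_ext_superset:
  assumes "finite A" "Poly_Mapping.keys f \<subseteq> A"
  shows "lin_ext g f = (\<Sum>xs\<in>A. free_scale (Poly_Mapping.lookup f xs) (g xs))"
  unfolding lin_ext_def using assms
  by (intro sum.mono_neutral_left) (auto simp: in_keys_iff free_scale_simps)

lemma lin_ext_add: "lin_ext g (f + h) = lin_ext g f + lin_ext g h"
proof -
  let ?A = "Poly_Mapping.keys f \<union> Poly_Mapping.keys h"
  have "lin_ext g k = (\<Sum>xs\<in>?A. free_scale (Poly_Mapping.lookup k xs) (g xs))"
    if "k \<in> {f, h, f + h}" for k
    using that Poly_Mapping.keys_add[of f h] by (intro lin_ext_superset) auto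
  then show ?thesis
    by (simp add: lookup_add free_scale_simps sum.distrib)
qed

lemma lin_ext_scale: "lin_ext g (free_scale r f) = free_scale r (lin_ext g f)"
proof -
  have "Poly_Mapping.keys (free_scale r f) \<subseteq> Poly_Mapping.keys f"
    by (auto simp: in_keys_iff lookup_free_scale)
  then have "lin_ext g (free_scale r f)
      = (\<Sum>xs\<in>Poly_Mapping.keys f. free_scale (Poly_Mapping.lookup (free_scale r f) xs) (g xs))"
    by (intro lin_ext_superset) auto
  then show ?thesis
    by (simp add: lookup_free_scale lin_ext_def free_scale_sum free_scale_simps)
qed

lemma lin_ext_uminus: "lin_ext g (- f) = - lin_ext g f"
  using lin_ext_scale[of g "- 1" f] by (simp add: free_scale_simps)

lemma lin_ext_diff: "lin_ext g (f - h) = lin_ext g f - lin_ext g h"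
  using lin_ext_add[of g f "- h"] by (simp add: lin_ext_uminus)

lemma lin_ext_gen: "lin_ext g (gen xs) = g xs"
proof -
  have "lin_ext g (gen xs)
      = (\<Sum>ys\<in>{xs}. free_scale (Poly_Mapping.lookup (gen xs) ys) (g ys))"
    by (intro lin_ext_superset) auto
  then show ?thesis
    by (simp add: free_scale_simps)
qed

lemma lin_ext_zero: "lin_ext g 0 = 0"
  by (simp add: lin_ext_def)

lemmas lin_ext_simps =
  lin_ext_add lin_ext_diff lin_ext_uminus lin_ext_gen lin_ext_zero lin_ext_scale

lemma lin_ext_sum: "lin_ext g (sum F A) = (\<Sum>a\<in>A. lin_ext g (F a))"
  by (induction A rule: infinite_finite_induct) (simp_all add: lin_ext_simps)

lemma lin_ext_lin_ext: "lin_ext g (lin_ext h f) = lin_ext (\<lambda>xs. lin_ext g (h xs)) f"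
  by (simp add: lin_ext_def[of h] lin_ext_def[of "\<lambda>xs. lin_ext g (h xs)"]
      lin_ext_sum lin_ext_scale)

lemma lin_ext_fun_diff: "lin_ext (\<lambda>xs. g xs - h xs) f = lin_ext g f - lin_ext h f"
  by (simp add: lin_ext_def free_scale_simps sum_subtractf)

lemma lin_ext_fun_add: "lin_ext (\<lambda>xs. g xs + h xs) f = lin_ext g f + lin_ext h f"
  by (simp add: lin_ext_def free_scale_simps sum.distrib)

definition free_submodule ::
  "('a, 'k::{comm_ring,comm_monoid_mult}) free_chain set \<Rightarrow> bool" where
  "free_submodule M \<longleftrightarrow>
     0 \<in> M \<and> (\<forall>f\<in>M. \<forall>g\<in>M. f + g \<in> M) \<and> (\<forall>r. \<forall>f\<in>M. free_scale r f \<in> M)"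

lemma free_submoduleD:
  assumes "free_submodule M"
  shows "0 \<in> M" "f \<in> M \<Longrightarrow> g \<in> M \<Longrightarrow> f + g \<in> M" "f \<in> M \<Longrightarrow> free_scale r f \<in> M"
  using assms by (auto simp: free_submodule_def)

lemma additive_subgroup_free_submodule: "free_submodule M \<Longrightarrow> additive_subgroup M"
  unfolding additive_subgroup_def
proof (intro conjI ballI)
  fix f g assume "free_submodule M" "f \<in> M" "g \<in> M"
  then have "f + free_scale (- 1) g \<in> M"
    by (intro free_submoduleD)
  then show "f - g \<in> M"
    by (simp add: free_scale_simps)
qed (rule free_submoduleD)

lemmas free_submodule_closed =
  additive_subgroup_closed[OF additive_subgroup_free_submodule]

lemma lin_ext_mem:
  assumes "free_submodule M" "\<And>xs. xs \<in> Poly_Mapping.keys f \<Longrightarrow> g xs \<in> M"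
  shows "lin_ext g f \<in> M"
proof -
  have "(\<Sum>xs\<in>A. free_scale (Poly_Mapping.lookup f xs) (g xs)) \<in> M"
    if "A \<subseteq> Poly_Mapping.keys f" for A
    using finite_subset[OF that finite_keys] that
    by (induction A rule: finite_induct) (auto intro!: free_submoduleD assms)
  then show ?thesis
    by (simp add: lin_ext_def)
qed

definition chains_of_degree ::
  "nat \<Rightarrow> ('a, 'k::{comm_ring,comm_monoid_mult}) free_chain set" where
  "chains_of_degree n = {f. \<forall>xs\<in>Poly_Mapping.keys f. length xs = Suc n}"

lemma free_submodule_chains_of_degree:
  "free_submodule (chains_of_degree n :: ('b, 'c::{comm_ring,comm_monoid_mult}) free_chain set)"
  unfolding free_submodule_def
proof (intro conjI ballI allI)
  fix f g :: "('b, 'c) free_chain"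
  assume "f \<in> chains_of_degree n" "g \<in> chains_of_degree n"
  with Poly_Mapping.keys_add[of f g] show "f + g \<in> chains_of_degree n"
    unfolding chains_of_degree_def by blast
next
  fix f :: "('b, 'c) free_chain" and r
  assume "f \<in> chains_of_degree n"
  moreover have "Poly_Mapping.keys (free_scale r f) \<subseteq> Poly_Mapping.keys f"
    by (auto simp: in_keys_iff lookup_free_scale)
  ultimately show "free_scale r f \<in> chains_of_degree n"
    unfolding chains_of_degree_def by blast
qed (simp add: chains_of_degree_def)

lemma gen_chains_of_degree: "length xs = Suc n \<Longrightarrow> gen xs \<in> chains_of_degree n"
  by (auto simp: chains_of_degree_def split: if_splits)

lemma lin_ext_mem_degree:
  assumes "free_submodule M"
  shows "f \<in> chains_of_degree 0 \<Longrightarrow> (\<And>a. g [a] \<in> M) \<Longrightarrow> lin_ext g f \<in> M"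
    and "f \<in> chains_of_degree (Suc 0) \<Longrightarrow> (\<And>a b. g [a, b] \<in> M) \<Longrightarrow> lin_ext g f \<in> M"
    and "f \<in> chains_of_degree (Suc (Suc 0)) \<Longrightarrow> (\<And>a b c. g [a, b, c] \<in> M) \<Longrightarrow> lin_ext g f \<in> M"
proof -
  have *: "lin_ext g f \<in> M"
    if "f \<in> chains_of_degree n" "\<And>xs. length xs = Suc n \<Longrightarrow> g xs \<in> M" for n
    using that by (intro lin_ext_mem[OF assms]) (auto simp: chains_of_degree_def)
  show "f \<in> chains_of_degree 0 \<Longrightarrow> (\<And>a. g [a] \<in> M) \<Longrightarrow> lin_ext g f \<in> M"
    by (rule *[of 0]) (auto simp: length_Suc_conv)
  show "f \<in> chains_of_degree (Suc 0) \<Longrightarrow> (\<And>a b. g [a, b] \<in> M) \<Longrightarrow> lin_ext g f \<in> M"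
    by (rule *[of "Suc 0"]) (auto simp: length_Suc_conv)
  show "f \<in> chains_of_degree (Suc (Suc 0)) \<Longrightarrow> (\<And>a b c. g [a, b, c] \<in> M) \<Longrightarrow> lin_ext g f \<in> M"
    by (rule *[of "Suc (Suc 0)"]) (auto simp: length_Suc_conv)
qed

lemma b_gen_simps:
  "b_gen (Suc 0) [a, b] = gen [a * b] - gen [b * a]"
  "b_gen (Suc (Suc 0)) [a, b, c] = gen [a * b, c] - gen [a, b * c] + gen [c * a, b]"
  by (simp_all add: b_gen_def single_uminus)

section \<open>Multilinear maps\<close>

definition k_linear ::
  "('k \<Rightarrow> 'a::{ring,monoid_mult} \<Rightarrow> 'a) \<Rightarrow> ('a \<Rightarrow> 'a) \<Rightarrow> bool" where
  "k_linear s l \<longleftrightarrow> (\<forall>x y. l (x + y) = l x + l y) \<and> (\<forall>r x. l (s r x) = s r (l x))"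

text \<open>A map out of the tensor power is well defined if its formula on lists is linear in every slot
  modulo the relations in the target.\<close>

definition linear_mod ::
  "('k::{comm_ring,comm_monoid_mult} \<Rightarrow> 'a::{ring,monoid_mult} \<Rightarrow> 'a) \<Rightarrow>
   ('a, 'k) free_chain set \<Rightarrow> ('a \<Rightarrow> ('a, 'k) free_chain) \<Rightarrow> bool" where
  "linear_mod s M F \<longleftrightarrow>
     (\<forall>x y. F (x + y) - F x - F y \<in> M) \<and> (\<forall>r x. F (s r x) - free_scale r (F x) \<in> M)"

lemma linear_mod_add:
  assumes "free_submodule M" "linear_mod s M F" "linear_mod s M G"
  shows "linear_mod s M (\<lambda>x. F x + G x)"
  unfolding linear_mod_def
proof (intro conjI allI)
  fix x y
  have "(F (x + y) - F x - F y) + (G (x + y) - G x - G y) \<in> M"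
    using assms by (intro free_submodule_closed(3)) (auto simp: linear_mod_def)
  then show "F (x + y) + G (x + y) - (F x + G x) - (F y + G y) \<in> M"
    by (simp add: algebra_simps)
next
  fix r x
  have "(F (s r x) - free_scale r (F x)) + (G (s r x) - free_scale r (G x)) \<in> M"
    using assms by (intro free_submodule_closed(3)) (auto simp: linear_mod_def)
  then show "F (s r x) + G (s r x) - free_scale r (F x + G x) \<in> M"
    by (simp add: algebra_simps free_scale_simps)
qed

lemma linear_mod_uminus:
  assumes "free_submodule M" "linear_mod s M F"
  shows "linear_mod s M (\<lambda>x. - F x)"
  unfolding linear_mod_def
proof (intro conjI allI)
  fix x y
  have "- (F (x + y) - F x - F y) \<in> M"
    using assms by (intro free_submodule_closed(2)) (auto simp: linear_mod_def)
  then show "- F (x + y) - (- F x) - (- F y) \<in> M"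
    by (simp add: algebra_simps)
next
  fix r x
  have "- (F (s r x) - free_scale r (F x)) \<in> M"
    using assms by (intro free_submodule_closed(2)) (auto simp: linear_mod_def)
  then show "- F (s r x) - free_scale r (- F x) \<in> M"
    by (simp add: algebra_simps free_scale_simps)
qed

lemma linear_mod_diff:
  assumes "free_submodule M" "linear_mod s M F" "linear_mod s M G"
  shows "linear_mod s M (\<lambda>x. F x - G x)"
  using linear_mod_add[OF assms(1,2) linear_mod_uminus[OF assms(1,3)]] by simp

lemma free_submodule_tensor_rel: "free_submodule (tensor_rel s n)"
  by (auto simp: free_submodule_def intro: tensor_rel.intros)

lemmas tensor_rel_closed = free_submodule_closed[OF free_submodule_tensor_rel]

text \<open>The base case of the multilinearity checks: all formulas below are sums of elementary tensors
  in which the varying argument enters exactly one slot, through a linear map.\<close>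

lemma linear_mod_gen:
  assumes "k_linear s l"
  shows "linear_mod s (tensor_rel s 0) (\<lambda>x. gen [l x])"
    and "linear_mod s (tensor_rel s (Suc 0)) (\<lambda>x. gen [l x, b])"
    and "linear_mod s (tensor_rel s (Suc 0)) (\<lambda>x. gen [a, l x])"
proof -
  have *: "linear_mod s (tensor_rel s n) (\<lambda>x. gen (xs[i := l x]))"
    if "length xs = Suc n" "i \<le> n" for xs n i
    using assms that
    by (simp add: linear_mod_def k_linear_def tensor_rel.additive tensor_rel.homogeneous)
  show "linear_mod s (tensor_rel s 0) (\<lambda>x. gen [l x])"
    and "linear_mod s (tensor_rel s (Suc 0)) (\<lambda>x. gen [l x, b])"
    and "linear_mod s (tensor_rel s (Suc 0)) (\<lambda>x. gen [a, l x])"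
    using *[of "[0]" 0 0] *[of "[0, b]" "Suc 0" 0] *[of "[a, 0]" "Suc 0" "Suc 0"] by simp_all
qed

lemma lin_ext_tensor_rel:
  assumes M: "free_submodule M"
    and g: "\<And>xs i. length xs = Suc n \<Longrightarrow> i \<le> n \<Longrightarrow> linear_mod s M (\<lambda>x. g (xs[i := x]))"
    and f: "f \<in> tensor_rel s n"
  shows "lin_ext g f \<in> M"
  using f
proof induction
  case (additive xs i x y)
  then show ?case
    using g[of xs i] by (simp add: lin_ext_simps linear_mod_def)
next
  case (homogeneous xs i r x)
  then show ?case
    using g[of xs i] by (simp add: lin_ext_simps linear_mod_def)
qed (auto simp: lin_ext_simps intro: free_submoduleD M)

lemma lin_ext_tensor_rel_degree:
  assumes "free_submodule M"
  shows "linear_mod s M (\<lambda>x. g [x]) \<Longrightarrow> f \<in> tensor_rel s 0 \<Longrightarrow> lin_ext g f \<in> M"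
    and "(\<And>a. linear_mod s M (\<lambda>x. g [x, a])) \<Longrightarrow> (\<And>a. linear_mod s M (\<lambda>x. g [a, x]))
      \<Longrightarrow> f \<in> tensor_rel s (Suc 0) \<Longrightarrow> lin_ext g f \<in> M"
    and "(\<And>a b. linear_mod s M (\<lambda>x. g [x, a, b])) \<Longrightarrow> (\<And>a b. linear_mod s M (\<lambda>x. g [a, x, b]))
      \<Longrightarrow> (\<And>a b. linear_mod s M (\<lambda>x. g [a, b, x]))
      \<Longrightarrow> f \<in> tensor_rel s (Suc (Suc 0)) \<Longrightarrow> lin_ext g f \<in> M"
proof -
  show "lin_ext g f \<in> M" if "linear_mod s M (\<lambda>x. g [x])" "f \<in> tensor_rel s 0"
    using that by (intro lin_ext_tensor_rel[OF assms _ that(2)]) (auto simp: length_Suc_conv)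
  show "lin_ext g f \<in> M"
    if "\<And>a. linear_mod s M (\<lambda>x. g [x, a])" "\<And>a. linear_mod s M (\<lambda>x. g [a, x])"
      "f \<in> tensor_rel s (Suc 0)"
    using that(1,2) by (intro lin_ext_tensor_rel[OF assms _ that(3)])
      (auto simp: length_Suc_conv le_Suc_eq)
  show "lin_ext g f \<in> M"
    if "\<And>a b. linear_mod s M (\<lambda>x. g [x, a, b])" "\<And>a b. linear_mod s M (\<lambda>x. g [a, x, b])"
      "\<And>a b. linear_mod s M (\<lambda>x. g [a, b, x])" "f \<in> tensor_rel s (Suc (Suc 0))"
    using that(1-3) by (intro lin_ext_tensor_rel[OF assms _ that(4)])
      (auto simp: length_Suc_conv le_Suc_eq)
qed

section \<open>Homology classes in degrees zero and one\<close>

text \<open>The formal combinations that represent zero in \<open>C\<^sub>n\<close> modulo boundaries. Working with them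
  replaces the two successive quotients by a single one.\<close>

definition null_chains ::
  "('k::{comm_ring,comm_monoid_mult} \<Rightarrow> 'a::{ring,monoid_mult} \<Rightarrow> 'a) \<Rightarrow> nat \<Rightarrow>
   ('a, 'k) free_chain set" where
  "null_chains s n = lin_ext (b_gen (Suc n)) ` chains_of_degree (Suc n) + tensor_rel s n"

text \<open>The image form, rather than a coset of cosets, makes sums of classes a pointwise computation;
  \<open>hclass_coset\<close> shows that both forms agree.\<close>

definition hclass ::
  "('k::{comm_ring,comm_monoid_mult} \<Rightarrow> 'a::{ring,monoid_mult} \<Rightarrow> 'a) \<Rightarrow> nat \<Rightarrow>
   ('a, 'k) free_chain \<Rightarrow> ('a, 'k) homology_class" where
  "hclass s n f = (\<lambda>g. g +o tensor_rel s n) ` (f +o null_chains s n)"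

definition free_cycles ::
  "('k::{comm_ring,comm_monoid_mult} \<Rightarrow> 'a::{ring,monoid_mult} \<Rightarrow> 'a) \<Rightarrow>
   ('a, 'k) free_chain set" where
  "free_cycles s =
     {f \<in> chains_of_degree (Suc 0). lin_ext (b_gen (Suc 0)) f \<in> tensor_rel s 0}"

lemma free_submodule_null_chains: "free_submodule (null_chains s n)"
  unfolding free_submodule_def
proof (intro conjI ballI allI)
  let ?b = "lin_ext (b_gen (Suc n))"
  have *: "?b h + t \<in> null_chains s n"
    if "h \<in> chains_of_degree (Suc n)" "t \<in> tensor_rel s n" for h t
    using that by (auto simp: null_chains_def)
  show "0 \<in> null_chains s n"
    using *[of 0 0] free_submodule_chains_of_degree
    by (auto simp: lin_ext_zero free_submodule_def intro: tensor_rel.zero)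
  fix f assume "f \<in> null_chains s n"
  then obtain h t where f: "f = ?b h + t" "h \<in> chains_of_degree (Suc n)" "t \<in> tensor_rel s n"
    by (auto simp: null_chains_def elim!: set_plus_elim)
  show "free_scale r f \<in> null_chains s n" for r
    using *[of "free_scale r h" "free_scale r t"] f(2,3)
    by (simp add: f(1) free_scale_simps lin_ext_scale
        free_submoduleD(3)[OF free_submodule_chains_of_degree] tensor_rel.scale)
  fix g assume "g \<in> null_chains s n"
  then obtain h' t' where
    g: "g = ?b h' + t'" "h' \<in> chains_of_degree (Suc n)" "t' \<in> tensor_rel s n"
    by (auto simp: null_chains_def elim!: set_plus_elim)
  show "f + g \<in> null_chains s n"
    using *[of "h + h'" "t + t'"] f(2,3) g(2,3)
    by (simp add: f(1) g(1) lin_ext_add tensor_rel.add add_ac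
        free_submoduleD(2)[OF free_submodule_chains_of_degree])
qed

lemmas null_closed = free_submodule_closed[OF free_submodule_null_chains]
lemmas subgroup_null = additive_subgroup_free_submodule[OF free_submodule_null_chains]
lemmas subgroup_tensor_rel = additive_subgroup_free_submodule[OF free_submodule_tensor_rel]

lemma b_null_chains:
  "h \<in> chains_of_degree (Suc n) \<Longrightarrow> lin_ext (b_gen (Suc n)) h \<in> null_chains s n"
  unfolding null_chains_def using set_plus_intro[OF imageI tensor_rel.zero] by fastforce

lemma tensor_rel_null_chains:
  assumes "f \<in> tensor_rel s n"
  shows "f \<in> null_chains s n"
proof -
  have "lin_ext (b_gen (Suc n)) 0 + f \<in> null_chains s n"
    unfolding null_chains_def using assms free_submoduleD(1)[OF free_submodule_chains_of_degree]
    by (intro set_plus_intro imageI)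
  then show ?thesis
    by (simp add: lin_ext_zero)
qed

text \<open>This is how an operation is shown to descend to homology: a null chain is a boundary plus
  tensor relations, and the two parts are treated separately.\<close>

lemma lin_ext_null_chains:
  assumes "free_submodule M"
    and "\<And>f. f \<in> tensor_rel s n \<Longrightarrow> lin_ext g f \<in> M"
    and "\<And>h. h \<in> chains_of_degree (Suc n) \<Longrightarrow> lin_ext g (lin_ext (b_gen (Suc n)) h) \<in> M"
    and "f \<in> null_chains s n"
  shows "lin_ext g f \<in> M"
proof -
  obtain h t where "f = lin_ext (b_gen (Suc n)) h + t"
      "h \<in> chains_of_degree (Suc n)" "t \<in> tensor_rel s n"
    using assms(4) by (auto simp: null_chains_def elim!: set_plus_elim)
  then show ?thesis
    using assms(2,3) by (simp add: lin_ext_add free_submoduleD(2)[OF assms(1)])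
qed

lemma hclass_eqI: "f - g \<in> null_chains s n \<Longrightarrow> hclass s n f = hclass s n g"
  by (simp add: hclass_def coset_eqI[OF subgroup_null])

lemma hclass_add: "hclass s n f + hclass s n g = hclass s n (f + g)"
proof -
  have img: "(\<lambda>g. g +o tensor_rel s n) ` A + (\<lambda>g. g +o tensor_rel s n) ` B
      = (\<lambda>g. g +o tensor_rel s n) ` (A + B)" for A B
    unfolding set_plus_def[of "_ ` _"] set_plus_def[of A]
    by (force simp flip: coset_add[OF subgroup_tensor_rel])
  show ?thesis
    unfolding hclass_def by (simp only: img coset_add[OF subgroup_null])
qed

lemma chain_map_coset:
  assumes "\<And>f. f \<in> tensor_rel s m \<Longrightarrow> lin_ext g f \<in> tensor_rel s n"
  shows "chain_map s n g (f +o tensor_rel s m) = lin_ext g f +o tensor_rel s n"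
  unfolding chain_map_def
proof (rule induced_coset[OF subgroup_tensor_rel subgroup_tensor_rel])
  show "lin_ext g v - lin_ext g f \<in> tensor_rel s n" if "v - f \<in> tensor_rel s m" for v
    using assms[OF that] by (simp add: lin_ext_diff)
qed

definition der_bracket :: "('a::{ring,monoid_mult} \<Rightarrow> 'a) \<Rightarrow> ('a \<Rightarrow> 'a) \<Rightarrow> 'a \<Rightarrow> 'a" where
  "der_bracket x y = (\<lambda>a. x (y a) - y (x a))"

definition lie_gen ::
  "nat \<Rightarrow> ('a \<Rightarrow> 'a) \<Rightarrow> 'a list \<Rightarrow> ('a, 'k::{comm_ring,comm_monoid_mult}) free_chain" where
  "lie_gen n x = (\<lambda>xs. \<Sum>i\<le>n. gen (xs[i := x (xs ! i)]))"

definition pairing_gen ::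
  "('a::{ring,monoid_mult} \<Rightarrow> 'a) \<Rightarrow> 'a list \<Rightarrow> ('a, 'k::{comm_ring,comm_monoid_mult}) free_chain" where
  "pairing_gen x = (\<lambda>xs. gen [x (xs ! 1) * xs ! 0])"

definition connes_gen ::
  "'a::{ring,monoid_mult} list \<Rightarrow> ('a, 'k::{comm_ring,comm_monoid_mult}) free_chain" where
  "connes_gen = (\<lambda>xs. gen [1, xs ! 0] + gen [xs ! 0, 1])"

definition center_gen ::
  "'a::{ring,monoid_mult} \<Rightarrow> 'a list \<Rightarrow> ('a, 'k::{comm_ring,comm_monoid_mult}) free_chain" where
  "center_gen z = (\<lambda>xs. gen ((z * hd xs) # tl xs))"

lemma gen_simps:
  "lie_gen 0 x [a] = gen [x a]"
  "lie_gen (Suc 0) x [a, b] = gen [x a, b] + gen [a, x b]"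
  "pairing_gen x [a, b] = gen [x b * a]"
  "connes_gen [a] = gen [1, a] + gen [a, 1]"
  "center_gen z (a # as) = gen ((z * a) # as)"
  by (simp_all add: lie_gen_def pairing_gen_def connes_gen_def center_gen_def)

lemmas calc = gen_simps b_gen_simps lin_ext_simps

context k_algebra
begin

lemma k_linear_intros:
  "k_linear s (\<lambda>x. x)"
  "k_linear s l \<Longrightarrow> k_linear s (\<lambda>x. c * l x)"
  "k_linear s l \<Longrightarrow> k_linear s (\<lambda>x. l x * c)"
  by (simp_all add: k_linear_def scale_mult_left scale_mult_right distrib_left distrib_right)

lemma k_linear_Der: "x \<in> Der s \<Longrightarrow> k_linear s l \<Longrightarrow> k_linear s (\<lambda>u. x (l u))"
  by (simp add: k_linear_def Der_def)

lemmas linear_intros =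
  linear_mod_add[OF free_submodule_tensor_rel] linear_mod_diff[OF free_submodule_tensor_rel]
  linear_mod_uminus[OF free_submodule_tensor_rel] linear_mod_gen k_linear_intros

text \<open>In the proofs of this kind, the rotated rule first consumes the membership of \<open>f\<close>; what
  remains is one linearity check for each slot of an explicit list.\<close>

lemma b_tensor_rel:
  assumes "n \<le> Suc 0" "f \<in> tensor_rel s (Suc n)"
  shows "lin_ext (b_gen (Suc n)) f \<in> tensor_rel s n"
proof -
  consider "n = 0" | "n = Suc 0"
    using assms(1) by linarith
  then show ?thesis
  proof cases
    case 1
    show ?thesis
      using assms(2) unfolding 1
      by (rule lin_ext_tensor_rel_degree(2)[OF free_submodule_tensor_rel, rotated 2];
          unfold b_gen_simps; intro linear_intros)
  next
    case 2
    show ?thesis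
      using assms(2) unfolding 2
      by (rule lin_ext_tensor_rel_degree(3)[OF free_submodule_tensor_rel, rotated 3];
          unfold b_gen_simps; intro linear_intros)
  qed
qed

lemma hochschild_b_coset:
  "n \<le> Suc 0 \<Longrightarrow>
    hochschild_b s n (f +o tensor_rel s (Suc n)) = lin_ext (b_gen (Suc n)) f +o tensor_rel s n"
  unfolding hochschild_b_def by (intro chain_map_coset b_tensor_rel)

text \<open>Adding tensor relations to a boundary does not change its class in \<open>C\<^sub>n\<close>.\<close>

lemma boundaries_eq:
  assumes "n \<le> Suc 0"
  shows "boundaries s n = (\<lambda>f. f +o tensor_rel s n) ` null_chains s n"
proof -
  have "C s (Suc n) = (\<lambda>f. f +o tensor_rel s (Suc n)) ` chains_of_degree (Suc n)"
    by (auto simp: C_def chains_of_degree_def)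
  then have "boundaries s n
      = (\<lambda>h. lin_ext (b_gen (Suc n)) h +o tensor_rel s n) ` chains_of_degree (Suc n)"
    by (simp add: boundaries_def image_image hochschild_b_coset assms)
  moreover have "(u + t) +o tensor_rel s n = u +o tensor_rel s n" if "t \<in> tensor_rel s n" for u t
    using that by (intro coset_eqI[OF subgroup_tensor_rel]) simp
  ultimately show ?thesis
    unfolding null_chains_def set_plus_def using tensor_rel.zero[of s n]
    by (fastforce simp: image_iff)
qed

lemma hclass_coset:
  assumes "n \<le> Suc 0"
  shows "(f +o tensor_rel s n) +o boundaries s n = hclass s n f"
  by (auto simp: boundaries_eq[OF assms] hclass_def elt_set_plus_def[of _ "_ :: _ set set"]
      elt_set_plus_def[of _ "null_chains s n"] image_iff coset_add[OF subgroup_tensor_rel])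

lemma induced_hclass:
  assumes "n \<le> Suc 0"
    and "\<And>v. \<phi> (v +o tensor_rel s m) = F v +o tensor_rel s n"
    and "\<And>v. v - f \<in> null_chains s m \<Longrightarrow> F v - F f \<in> null_chains s n"
  shows "induced (boundaries s n) \<phi> (hclass s m f) = hclass s n (F f)"
proof -
  have "induced (boundaries s n) \<phi> (hclass s m f) = (\<Union>v\<in>f +o null_chains s m. hclass s n (F v))"
    by (simp add: induced_def hclass_def[of s m] assms(2) hclass_coset[OF assms(1)])
  also have "\<dots> = hclass s n (F f)"
    using assms(3) by (intro UN_coset[OF subgroup_null] hclass_eqI)
  finally show ?thesis .
qed

text \<open>The passage from operations on homology classes to operations on formal combinations.\<close>

lemma chain_map_hclass:
  assumes "n \<le> Suc 0"
    and "\<And>f. f \<in> tensor_rel s m \<Longrightarrow> lin_ext g f \<in> tensor_rel s n"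
    and "\<And>f. f \<in> null_chains s m \<Longrightarrow> lin_ext g f \<in> null_chains s n"
  shows "induced (boundaries s n) (chain_map s n g) (hclass s m f) = hclass s n (lin_ext g f)"
proof (rule induced_hclass[OF assms(1)])
  show "chain_map s n g (v +o tensor_rel s m) = lin_ext g v +o tensor_rel s n" for v
    by (rule chain_map_coset) (rule assms(2))
  show "lin_ext g v - lin_ext g f \<in> null_chains s n" if "v - f \<in> null_chains s m" for v
    using assms(3)[OF that] by (simp add: lin_ext_diff)
qed

lemma HH_scale_hclass:
  assumes "n \<le> Suc 0"
  shows "HH_scale s n r (hclass s n f) = hclass s n (free_scale r f)"
  unfolding HH_scale_def
proof (rule induced_hclass[OF assms])
  show "induced (tensor_rel s n) (free_scale r) (v +o tensor_rel s n)
      = free_scale r v +o tensor_rel s n" for v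
    by (rule induced_coset[OF subgroup_tensor_rel subgroup_tensor_rel])
      (metis free_scale_simps(2) tensor_rel.scale)
  show "free_scale r v - free_scale r f \<in> null_chains s n" if "v - f \<in> null_chains s n" for v
    using free_submoduleD(3)[OF free_submodule_null_chains that] by (metis free_scale_simps(2))
qed

lemma HH_minus_hclass:
  "n \<le> Suc 0 \<Longrightarrow> HH_minus s n (hclass s n f) (hclass s n g) = hclass s n (f - g)"
  by (simp add: HH_minus_def HH_scale_hclass hclass_add free_scale_simps)

lemma HH_0_eq: "HH s 0 = hclass s 0 ` chains_of_degree 0"
  by (auto simp: HH_def cycles_def C_def chains_of_degree_def image_iff
      simp flip: hclass_coset[of 0])

lemma HH_1_eq: "HH s (Suc 0) = hclass s (Suc 0) ` free_cycles s"
proof -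
  have "f +o tensor_rel s 0 = tensor_rel s 0 \<longleftrightarrow> f \<in> tensor_rel s 0" for f
  proof
    assume "f +o tensor_rel s 0 = tensor_rel s 0"
    then show "f \<in> tensor_rel s 0"
      using set_plus_intro2[of 0 "tensor_rel s 0" f] by (simp add: tensor_rel.zero)
  next
    assume "f \<in> tensor_rel s 0"
    then show "f +o tensor_rel s 0 = tensor_rel s 0"
      using coset_eqI[OF subgroup_tensor_rel, of f 0] by simp
  qed
  then have "hochschild_b s 0 (f +o tensor_rel s (Suc 0)) = tensor_rel s 0
      \<longleftrightarrow> lin_ext (b_gen (Suc 0)) f \<in> tensor_rel s 0" for f
    by (simp only: hochschild_b_coset le0)
  then have "cycles s (Suc 0) = (\<lambda>f. f +o tensor_rel s (Suc 0)) ` free_cycles s"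
    by (auto simp: cycles_def C_def free_cycles_def chains_of_degree_def)
  then show ?thesis
    by (auto simp: HH_def image_iff simp flip: hclass_coset[of "Suc 0"])
qed


section \<open>Derivations\<close>

lemma Der_simps:
  assumes "x \<in> Der s"
  shows "x (a + b) = x a + x b" "x (s r a) = s r (x a)" "x (a * b) = x a * b + a * x b"
    and "x 0 = 0" "x (- a) = - x a" "x (a - b) = x a - x b" "x 1 = 0"
proof -
  show add: "x (a + b) = x a + x b"
    and "x (s r a) = s r (x a)" and mult: "x (a * b) = x a * b + a * x b" for a b
    using assms by (auto simp: Der_def)
  show zero: "x 0 = 0"
    using add[of 0 0] by simp
  show uminus: "x (- a) = - x a" for a
    using add[of a "- a"] zero by (simp add: eq_neg_iff_add_eq_0 add.commute)
  show "x (a - b) = x a - x b"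
    using add[of a "- b"] uminus[of b] by simp
  show "x 1 = 0"
    using mult[of 1 1] by simp
qed

lemma scale_diff_right: "s r (a - b) = s r a - s r b"
  using scale_add_right[of r "a - b" b] by (simp add: algebra_simps)

lemma subgroup_Inn: "additive_subgroup (Inn :: ('a \<Rightarrow> 'a) set)"
proof -
  have "(\<lambda>b. c * b - b * c) - (\<lambda>b. d * b - b * d) = (\<lambda>b. (c - d) * b - b * (c - d))" for c d :: 'a
    by (rule ext) (simp add: algebra_simps)
  moreover have "0 = (\<lambda>b. 0 * b - b * (0::'a))"
    by (rule ext) simp
  ultimately show ?thesis
    unfolding additive_subgroup_def Inn_def by (auto simp only: image_iff)
qed

lemma InnI: "x = (\<lambda>b. c * b - b * c) \<Longrightarrow> x \<in> Inn"
  by (auto simp: Inn_def)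

lemma diff_InnE:
  fixes v x :: "'a \<Rightarrow> 'a"
  assumes "v - x \<in> Inn"
  obtains c where "v = (\<lambda>b. x b + (c * b - b * c))"
proof -
  obtain c where "v - x = (\<lambda>b. c * b - b * c)"
    using assms by (auto simp: Inn_def)
  then have "v = (\<lambda>b. x b + (c * b - b * c))"
    by (auto simp: fun_eq_iff algebra_simps)
  then show thesis
    by (rule that)
qed

lemma center_left_commute:
  fixes z a b :: 'a
  assumes "z \<in> center"
  shows "a * (z * b) = z * (a * b)"
proof -
  have "a * z = z * a"
    using assms by (simp add: center_def)
  then show ?thesis
    by (metis mult.assoc)
qed

lemma Der_closed:
  assumes "x \<in> Der s"
  shows "y \<in> Der s \<Longrightarrow> der_bracket x y \<in> Der s"
    and "z \<in> center \<Longrightarrow> (\<lambda>a. z * x a) \<in> Der s"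
    and "v - x \<in> Inn \<Longrightarrow> v \<in> Der s"
proof -
  note x = Der_simps[OF assms]
  show "der_bracket x y \<in> Der s" if "y \<in> Der s"
    by (simp add: Der_def der_bracket_def x Der_simps[OF that] algebra_simps scale_diff_right)
  show "(\<lambda>a. z * x a) \<in> Der s" if "z \<in> center"
    by (simp add: Der_def x distrib_left mult.assoc scale_mult_right center_left_commute[OF that])
  show "v \<in> Der s" if v: "v - x \<in> Inn"
  proof -
    obtain c where "v = (\<lambda>b. x b + (c * b - b * c))"
      using v by (rule diff_InnE)
    then show ?thesis
      by (simp add: Der_def x algebra_simps scale_add_right scale_diff_right
          scale_mult_left scale_mult_right)
  qed
qed

text \<open>Inner derivations form an ideal: \<open>[x, [c, \<cdot>]] = [x(c), \<cdot>]\<close> gives the witnesses below.\<close>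

lemma H1_bracket_coset:
  assumes "x \<in> Der s" "y \<in> Der s"
  shows "H1_bracket (x +o Inn) (y +o Inn) = der_bracket x y +o Inn"
  unfolding H1_bracket_def
proof (rule UN_coset[OF subgroup_Inn])
  fix v assume v: "v - x \<in> Inn"
  note v_der = Der_simps[OF Der_closed(3)[OF assms(1) v]]
  have "induced Inn (\<lambda>y a. v (y a) - y (v a)) (y +o Inn) = der_bracket v y +o Inn"
    unfolding der_bracket_def
  proof (rule induced_coset[OF subgroup_Inn subgroup_Inn])
    fix w assume "w - y \<in> Inn"
    then obtain c where w: "w = (\<lambda>b. y b + (c * b - b * c))"
      by (rule diff_InnE)
    show "(\<lambda>a. v (w a) - w (v a)) - (\<lambda>a. v (y a) - y (v a)) \<in> Inn"
      by (rule InnI[of _ "v c"]) (simp add: fun_eq_iff w v_der algebra_simps)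
  qed
  also have "\<dots> = der_bracket x y +o Inn"
  proof (rule coset_eqI[OF subgroup_Inn])
    obtain c where c: "v = (\<lambda>b. x b + (c * b - b * c))"
      using v by (rule diff_InnE)
    show "der_bracket v y - der_bracket x y \<in> Inn"
      by (rule InnI[of _ "- y c"])
        (simp add: fun_eq_iff der_bracket_def c Der_simps[OF assms(2)] algebra_simps)
  qed
  finally show "induced Inn (\<lambda>y a. v (y a) - y (v a)) (y +o Inn) = der_bracket x y +o Inn" .
qed

lemma H1_center_mult_coset:
  fixes x :: "'a \<Rightarrow> 'a"
  assumes "z \<in> center"
  shows "H1_center_mult z (x +o Inn) = (\<lambda>a. z * x a) +o Inn"
  unfolding H1_center_mult_def
proof (rule induced_coset[OF subgroup_Inn subgroup_Inn])
  fix v assume "v - x \<in> Inn"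
  then obtain c where v: "v = (\<lambda>b. x b + (c * b - b * c))"
    by (rule diff_InnE)
  show "(\<lambda>a. z * v a) - (\<lambda>a. z * x a) \<in> Inn"
    by (rule InnI[of _ "z * c"])
      (simp add: fun_eq_iff v distrib_left right_diff_distrib mult.assoc
        center_left_commute[OF assms])
qed

lemma scale_zero: "s r 0 = 0"
  using scale_diff_right[of r 0 0] by simp

lemma H1_scale_Inn: "H1_scale s r Inn = (Inn :: ('a \<Rightarrow> 'a) set)"
proof -
  have "induced Inn (\<lambda>x a. s r (x a)) (0 +o Inn) = (\<lambda>a. s r (0 a)) +o (Inn :: ('a \<Rightarrow> 'a) set)"
  proof (rule induced_coset[OF subgroup_Inn subgroup_Inn])
    fix v :: "'a \<Rightarrow> 'a" assume "v - 0 \<in> Inn"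
    then obtain c where v: "v = (\<lambda>b. 0 b + (c * b - b * c))"
      by (rule diff_InnE)
    show "(\<lambda>a. s r (v a)) - (\<lambda>a. s r (0 a)) \<in> Inn"
      by (rule InnI[of _ "s r c"])
        (simp add: fun_eq_iff v scale_diff_right scale_mult_left scale_mult_right scale_zero)
  qed
  then show ?thesis
    by (simp add: H1_scale_def scale_zero zero_fun_def[symmetric])
qed

text \<open>An inner derivation vanishes on the center, so the value does not depend on the
  representative.\<close>

lemma H1_apply_coset:
  fixes x :: "'a \<Rightarrow> 'a"
  assumes "z \<in> center"
  shows "H1_apply (x +o Inn) z = x z"
proof -
  have *: "v z = x z" if v: "v \<in> x +o Inn" for v
  proof -
    obtain c where "v = (\<lambda>b. x b + (c * b - b * c))"
      using v unfolding mem_coset_iff by (rule diff_InnE)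
    moreover have "z * c = c * z"
      using assms by (simp add: center_def)
    ultimately show ?thesis
      by simp
  qed
  have "x \<in> x +o Inn"
    using subgroup_Inn by (simp add: mem_coset_iff additive_subgroup_closed)
  then have "w = x z" if w: "\<forall>v\<in>x +o Inn. v z = w" for w
    by (rule bspec[OF w, THEN sym])
  with * show ?thesis
    unfolding H1_apply_def by (intro the_equality ballI) blast+
qed

text \<open>Applying \<open>x\<close> to \<open>z a = a z\<close> leaves \<open>x(z) a = a x(z)\<close> once the terms \<open>z x(a) = x(a) z\<close> are
  cancelled.\<close>

lemma Der_center:
  assumes "x \<in> Der s" "z \<in> center"
  shows "x z \<in> center"
  unfolding center_def
proof (intro CollectI allI)
  fix a
  have "x (z * a) = x (a * z)"
    using assms(2) by (simp add: center_def)
  moreover have "z * x a = x a * z"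
    using assms(2) by (simp add: center_def)
  ultimately show "x z * a = a * x z"
    by (simp add: Der_simps[OF assms(1)])
qed


section \<open>Cartan calculus on free chains\<close>

lemma linear_mod_zero_diff:
  assumes "free_submodule M" "linear_mod s M F"
  shows "F 0 \<in> M" "F (u - v) - F u + F v \<in> M" "F (u + v) - F u - F v \<in> M"
proof -
  have "- (F (0 + 0) - F 0 - F 0) \<in> M" "- (F ((u - v) + v) - F (u - v) - F v) \<in> M"
    using assms(2) by (auto simp only: linear_mod_def intro!: free_submodule_closed(2)[OF assms(1)])
  then show "F 0 \<in> M" "F (u - v) - F u + F v \<in> M"
    by (simp_all add: algebra_simps)
  show "F (u + v) - F u - F v \<in> M"
    using assms(2) by (simp add: linear_mod_def)
qed

lemmas tensor_zero_0 =
  linear_mod_zero_diff(1)[OF free_submodule_tensor_rel linear_mod_gen(1)[OF k_linear_intros(1)]]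
lemmas tensor_zero_left =
  linear_mod_zero_diff(1)[OF free_submodule_tensor_rel linear_mod_gen(2)[OF k_linear_intros(1)]]
lemmas tensor_zero_right =
  linear_mod_zero_diff(1)[OF free_submodule_tensor_rel linear_mod_gen(3)[OF k_linear_intros(1)]]
lemmas tensor_diff_0 =
  linear_mod_zero_diff(2)[OF free_submodule_tensor_rel linear_mod_gen(1)[OF k_linear_intros(1)]]
lemmas tensor_diff_left =
  linear_mod_zero_diff(2)[OF free_submodule_tensor_rel linear_mod_gen(2)[OF k_linear_intros(1)]]
lemmas tensor_diff_right =
  linear_mod_zero_diff(2)[OF free_submodule_tensor_rel linear_mod_gen(3)[OF k_linear_intros(1)]]
lemmas tensor_add_0 =
  linear_mod_zero_diff(3)[OF free_submodule_tensor_rel linear_mod_gen(1)[OF k_linear_intros(1)]]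
lemmas tensor_add_left =
  linear_mod_zero_diff(3)[OF free_submodule_tensor_rel linear_mod_gen(2)[OF k_linear_intros(1)]]
lemmas tensor_add_right =
  linear_mod_zero_diff(3)[OF free_submodule_tensor_rel linear_mod_gen(3)[OF k_linear_intros(1)]]

text \<open>In the calculations below, the first premise exhibits a combination of known relations and the
  second is an identity of formal sums.\<close>

lemma mem_by_eq: "g \<in> M \<Longrightarrow> f = g \<Longrightarrow> f \<in> M"
  by simp

lemma null_commutator: "gen [a * b] - gen [b * a] \<in> null_chains s 0"
  using b_null_chains[OF gen_chains_of_degree, of "[a, b]" 0] by (simp add: calc)

lemma null_leibniz: "gen [a * b, c] - gen [a, b * c] + gen [c * a, b] \<in> null_chains s (Suc 0)"
  using b_null_chains[OF gen_chains_of_degree, of "[a, b, c]" "Suc 0"] by (simp add: calc)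

text \<open>\<open>b(a \<otimes> 1 \<otimes> 1) = a \<otimes> 1\<close>, so of the two terms in the formula for \<open>B\<close> only \<open>1 \<otimes> a\<close> matters.\<close>

lemma null_unit_right: "gen [a, 1] \<in> null_chains s (Suc 0)"
  using null_leibniz[of a 1 1] by simp

text \<open>The boundary of \<open>1 \<otimes> a \<otimes> b\<close>. Reading \<open>a \<otimes> b\<close> as \<open>a B(b)\<close>, this is the Leibniz rule
  for \<open>B(ab)\<close>.\<close>

lemma null_exact: "gen [1, a * b] - gen [a, b] - gen [b, a] \<in> null_chains s (Suc 0)"
  by (rule mem_by_eq[OF null_closed(2)[OF null_leibniz[of 1 a b]]]) simp

lemma lie_tensor_rel:
  assumes "x \<in> Der s"
  shows "f \<in> tensor_rel s 0 \<Longrightarrow> lin_ext (lie_gen 0 x) f \<in> tensor_rel s 0"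
    and "f \<in> tensor_rel s (Suc 0) \<Longrightarrow> lin_ext (lie_gen (Suc 0) x) f \<in> tensor_rel s (Suc 0)"
proof -
  show "lin_ext (lie_gen 0 x) f \<in> tensor_rel s 0" if "f \<in> tensor_rel s 0"
    using that
    by (rule lin_ext_tensor_rel_degree(1)[OF free_submodule_tensor_rel, rotated];
        unfold gen_simps; intro linear_intros k_linear_Der[OF assms])
  show "lin_ext (lie_gen (Suc 0) x) f \<in> tensor_rel s (Suc 0)" if "f \<in> tensor_rel s (Suc 0)"
    using that
    by (rule lin_ext_tensor_rel_degree(2)[OF free_submodule_tensor_rel, rotated 2];
        unfold gen_simps; intro linear_intros k_linear_Der[OF assms])
qed

lemma pairing_tensor_rel:
  assumes "x \<in> Der s" "f \<in> tensor_rel s (Suc 0)"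
  shows "lin_ext (pairing_gen x) f \<in> tensor_rel s 0"
  using assms(2)
  by (rule lin_ext_tensor_rel_degree(2)[OF free_submodule_tensor_rel, rotated 2];
      unfold gen_simps; intro linear_intros k_linear_Der[OF assms(1)])

lemma connes_tensor_rel:
  assumes "f \<in> tensor_rel s 0"
  shows "lin_ext connes_gen f \<in> tensor_rel s (Suc 0)"
  using assms
  by (rule lin_ext_tensor_rel_degree(1)[OF free_submodule_tensor_rel, rotated];
      unfold gen_simps; intro linear_intros)

lemma center_tensor_rel:
  "f \<in> tensor_rel s 0 \<Longrightarrow> lin_ext (center_gen z) f \<in> tensor_rel s 0"
  "f \<in> tensor_rel s (Suc 0) \<Longrightarrow> lin_ext (center_gen z) f \<in> tensor_rel s (Suc 0)"
proof -
  show "lin_ext (center_gen z) f \<in> tensor_rel s 0" if "f \<in> tensor_rel s 0"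
    using that
    by (rule lin_ext_tensor_rel_degree(1)[OF free_submodule_tensor_rel, rotated];
        unfold gen_simps; intro linear_intros)
  show "lin_ext (center_gen z) f \<in> tensor_rel s (Suc 0)" if "f \<in> tensor_rel s (Suc 0)"
    using that
    by (rule lin_ext_tensor_rel_degree(2)[OF free_submodule_tensor_rel, rotated 2];
        unfold gen_simps; intro linear_intros)
qed

lemma lie_null_0:
  assumes "x \<in> Der s" "f \<in> null_chains s 0"
  shows "lin_ext (lie_gen 0 x) f \<in> null_chains s 0"
proof (rule lin_ext_null_chains[OF free_submodule_null_chains _ _ assms(2)])
  show "lin_ext (lie_gen 0 x) f \<in> null_chains s 0" if "f \<in> tensor_rel s 0" for f
    by (intro tensor_rel_null_chains lie_tensor_rel assms(1) that)
  fix h :: "('a, 'k) free_chain" assume "h \<in> chains_of_degree (Suc 0)"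
  then show "lin_ext (lie_gen 0 x) (lin_ext (b_gen (Suc 0)) h) \<in> null_chains s 0"
    unfolding lin_ext_lin_ext
  proof (rule lin_ext_mem_degree(2)[OF free_submodule_null_chains])
    fix a b
    show "lin_ext (lie_gen 0 x) (b_gen (Suc 0) [a, b]) \<in> null_chains s 0"
      by (rule mem_by_eq[OF null_closed(3)[OF null_closed(4)[OF
          tensor_rel_null_chains[OF tensor_add_0[of "x a * b" "a * x b"]]
          tensor_rel_null_chains[OF tensor_add_0[of "x b * a" "b * x a"]]]
          null_closed(3)[OF null_commutator[of "x a" b] null_commutator[of a "x b"]]]])
        (simp add: calc Der_simps[OF assms(1)] algebra_simps)
  qed
qed

text \<open>\<open>L\<^sub>x\<close> commutes with the boundary modulo tensor relations: applied to the boundary of \<open>a \<otimes> b \<otimes> c\<close>, it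
  gives the sum of the boundaries of \<open>x(a) \<otimes> b \<otimes> c\<close>, \<open>a \<otimes> x(b) \<otimes> c\<close> and \<open>a \<otimes> b \<otimes> x(c)\<close>.\<close>

lemma lie_null_1:
  assumes "x \<in> Der s" "f \<in> null_chains s (Suc 0)"
  shows "lin_ext (lie_gen (Suc 0) x) f \<in> null_chains s (Suc 0)"
proof (rule lin_ext_null_chains[OF free_submodule_null_chains _ _ assms(2)])
  show "lin_ext (lie_gen (Suc 0) x) f \<in> null_chains s (Suc 0)" if "f \<in> tensor_rel s (Suc 0)" for f
    by (intro tensor_rel_null_chains lie_tensor_rel assms(1) that)
  fix h :: "('a, 'k) free_chain" assume "h \<in> chains_of_degree (Suc (Suc 0))"
  then show "lin_ext (lie_gen (Suc 0) x) (lin_ext (b_gen (Suc (Suc 0))) h) \<in> null_chains s (Suc 0)"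
    unfolding lin_ext_lin_ext
  proof (rule lin_ext_mem_degree(3)[OF free_submodule_null_chains])
    fix a b c
    show "lin_ext (lie_gen (Suc 0) x) (b_gen (Suc (Suc 0)) [a, b, c]) \<in> null_chains s (Suc 0)"
      by (rule mem_by_eq[OF null_closed(3)[OF null_closed(3)[OF null_closed(3)[OF
            null_leibniz[of "x a" b c] null_leibniz[of a "x b" c]] null_leibniz[of a b "x c"]]
          tensor_rel_null_chains[OF tensor_rel_closed(3)[OF tensor_rel_closed(4)[OF
            tensor_add_left[of "x a * b" "a * x b" c]
            tensor_add_right[of a "x b * c" "b * x c"]]
            tensor_add_left[of "x c * a" "c * x a" b]]]]])
        (simp add: calc Der_simps[OF assms(1)] algebra_simps)
  qed
qed

text \<open>By the derivation rule, \<open>i\<^sub>x\<close> sends the boundary of \<open>a \<otimes> b \<otimes> c\<close> to the commutator of \<open>x(c) a\<close>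
  and \<open>b\<close>.\<close>

lemma pairing_null:
  assumes "x \<in> Der s" "f \<in> null_chains s (Suc 0)"
  shows "lin_ext (pairing_gen x) f \<in> null_chains s 0"
proof (rule lin_ext_null_chains[OF free_submodule_null_chains _ _ assms(2)])
  show "lin_ext (pairing_gen x) f \<in> null_chains s 0" if "f \<in> tensor_rel s (Suc 0)" for f
    by (intro tensor_rel_null_chains pairing_tensor_rel assms(1) that)
  fix h :: "('a, 'k) free_chain" assume "h \<in> chains_of_degree (Suc (Suc 0))"
  then show "lin_ext (pairing_gen x) (lin_ext (b_gen (Suc (Suc 0))) h) \<in> null_chains s 0"
    unfolding lin_ext_lin_ext
  proof (rule lin_ext_mem_degree(3)[OF free_submodule_null_chains])
    fix a b c
    show "lin_ext (pairing_gen x) (b_gen (Suc (Suc 0)) [a, b, c]) \<in> null_chains s 0"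
      by (rule mem_by_eq[OF null_closed(4)[OF null_commutator[of "x c * a" b]
          tensor_rel_null_chains[OF tensor_add_0[of "x b * c * a" "b * x c * a"]]]])
        (simp add: calc Der_simps[OF assms(1)] algebra_simps)
  qed
qed

text \<open>The right-hand side of the Leibniz rule \<open>null_exact\<close> is symmetric in the two factors, hence \<open>B\<close>
  kills commutators.\<close>

lemma connes_null:
  assumes "f \<in> null_chains s 0"
  shows "lin_ext connes_gen f \<in> null_chains s (Suc 0)"
proof (rule lin_ext_null_chains[OF free_submodule_null_chains _ _ assms])
  show "lin_ext connes_gen f \<in> null_chains s (Suc 0)" if "f \<in> tensor_rel s 0" for f
    by (intro tensor_rel_null_chains connes_tensor_rel that)
  fix h :: "('a, 'k) free_chain" assume "h \<in> chains_of_degree (Suc 0)"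
  then show "lin_ext connes_gen (lin_ext (b_gen (Suc 0)) h) \<in> null_chains s (Suc 0)"
    unfolding lin_ext_lin_ext
  proof (rule lin_ext_mem_degree(2)[OF free_submodule_null_chains])
    fix a b
    show "lin_ext connes_gen (b_gen (Suc 0) [a, b]) \<in> null_chains s (Suc 0)"
      by (rule mem_by_eq[OF null_closed(4)[OF
          null_closed(3)[OF null_exact[of a b] null_unit_right[of "a * b"]]
          null_closed(3)[OF null_exact[of b a] null_unit_right[of "b * a"]]]])
        (simp add: calc algebra_simps)
  qed
qed

lemma center_null:
  assumes "z \<in> center" "f \<in> null_chains s (Suc 0)"
  shows "lin_ext (center_gen z) f \<in> null_chains s (Suc 0)"
proof (rule lin_ext_null_chains[OF free_submodule_null_chains _ _ assms(2)])
  show "lin_ext (center_gen z) f \<in> null_chains s (Suc 0)" if "f \<in> tensor_rel s (Suc 0)" for f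
    by (intro tensor_rel_null_chains center_tensor_rel that)
  fix h :: "('a, 'k) free_chain" assume "h \<in> chains_of_degree (Suc (Suc 0))"
  then show "lin_ext (center_gen z) (lin_ext (b_gen (Suc (Suc 0))) h) \<in> null_chains s (Suc 0)"
    unfolding lin_ext_lin_ext
  proof (rule lin_ext_mem_degree(3)[OF free_submodule_null_chains])
    fix a b c
    show "lin_ext (center_gen z) (b_gen (Suc (Suc 0)) [a, b, c]) \<in> null_chains s (Suc 0)"
      by (rule mem_by_eq[OF null_leibniz[of "z * a" b c]])
        (simp add: calc mult.assoc center_left_commute[OF assms(1)])
  qed
qed

lemma free_cycles_b_tensor_rel:
  "f \<in> free_cycles s \<Longrightarrow> lin_ext (b_gen (Suc 0)) f \<in> tensor_rel s 0"
  and free_cycles_degree: "f \<in> free_cycles s \<Longrightarrow> f \<in> chains_of_degree (Suc 0)"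
  by (simp_all add: free_cycles_def)

lemma free_submodule_free_cycles: "free_submodule (free_cycles s)"
  using free_submodule_chains_of_degree[of "Suc 0", where 'b = 'a and 'c = 'k]
    free_submodule_tensor_rel[of s 0]
  by (auto simp: free_submodule_def free_cycles_def lin_ext_simps)

text \<open>The boundary from degree one to degree zero intertwines the two Lie derivatives.\<close>

lemma lie_free_cycles:
  assumes "x \<in> Der s" "f \<in> free_cycles s"
  shows "lin_ext (lie_gen (Suc 0) x) f \<in> free_cycles s"
proof -
  let ?b = "lin_ext (b_gen (Suc 0))"
  have "?b (lin_ext (lie_gen (Suc 0) x) f) - lin_ext (lie_gen 0 x) (?b f) \<in> tensor_rel s 0"
    unfolding lin_ext_lin_ext lin_ext_fun_diff[symmetric]
  proof (rule lin_ext_mem_degree(2)[OF free_submodule_tensor_rel free_cycles_degree[OF assms(2)]])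
    fix a b
    show "?b (lie_gen (Suc 0) x [a, b]) - lin_ext (lie_gen 0 x) (b_gen (Suc 0) [a, b])
        \<in> tensor_rel s 0"
      by (rule mem_by_eq[OF tensor_rel_closed(4)[OF
            tensor_add_0[of "x b * a" "b * x a"] tensor_add_0[of "x a * b" "a * x b"]]])
        (simp add: calc Der_simps[OF assms(1)] algebra_simps)
  qed
  from tensor_rel_closed(3)[OF this
      lie_tensor_rel(1)[OF assms(1) free_cycles_b_tensor_rel[OF assms(2)]]]
  have "?b (lin_ext (lie_gen (Suc 0) x) f) \<in> tensor_rel s 0"
    by simp
  moreover have "lin_ext (lie_gen (Suc 0) x) f \<in> chains_of_degree (Suc 0)"
    by (rule lin_ext_mem_degree(2)[OF free_submodule_chains_of_degree
          free_cycles_degree[OF assms(2)]], unfold gen_simps)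
      (intro free_submoduleD(2)[OF free_submodule_chains_of_degree] gen_chains_of_degree; simp)
  ultimately show ?thesis
    by (simp add: free_cycles_def)
qed

lemma pairing_degree:
  "f \<in> free_cycles s \<Longrightarrow> lin_ext (pairing_gen x) f \<in> chains_of_degree 0"
  by (rule lin_ext_mem_degree(2)[OF free_submodule_chains_of_degree free_cycles_degree])
    (simp_all add: gen_simps gen_chains_of_degree)

lemma connes_free_cycles:
  assumes "h \<in> chains_of_degree 0"
  shows "lin_ext connes_gen h \<in> free_cycles s"
  using assms
proof (rule lin_ext_mem_degree(1)[OF free_submodule_free_cycles])
  show "connes_gen [a] \<in> free_cycles s" for a
    by (auto simp: free_cycles_def calc tensor_rel.zero
        intro!: free_submoduleD(2)[OF free_submodule_chains_of_degree] gen_chains_of_degree)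
qed

lemma center_free_cycles:
  assumes "z \<in> center" "f \<in> free_cycles s"
  shows "lin_ext (center_gen z) f \<in> free_cycles s"
proof -
  let ?b = "lin_ext (b_gen (Suc 0))"
  have "?b (lin_ext (center_gen z) f) - lin_ext (center_gen z) (?b f) \<in> tensor_rel s 0"
    unfolding lin_ext_lin_ext lin_ext_fun_diff[symmetric]
  proof (rule lin_ext_mem_degree(2)[OF free_submodule_tensor_rel free_cycles_degree[OF assms(2)]])
    fix a b
    show "?b (center_gen z [a, b]) - lin_ext (center_gen z) (b_gen (Suc 0) [a, b])
        \<in> tensor_rel s 0"
      by (simp add: calc mult.assoc center_left_commute[OF assms(1)] tensor_rel.zero)
  qed
  from tensor_rel_closed(3)[OF this
      center_tensor_rel(1)[OF free_cycles_b_tensor_rel[OF assms(2)], of z]]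
  have "?b (lin_ext (center_gen z) f) \<in> tensor_rel s 0"
    by simp
  moreover have "lin_ext (center_gen z) f \<in> chains_of_degree (Suc 0)"
    by (rule lin_ext_mem_degree(2)[OF free_submodule_chains_of_degree
          free_cycles_degree[OF assms(2)]])
      (simp add: gen_simps gen_chains_of_degree)
  ultimately show ?thesis
    by (simp add: free_cycles_def)
qed


section \<open>Independence of the representing derivation\<close>

lemma lie_inner_0:
  assumes "v - x \<in> Inn" "f \<in> chains_of_degree 0"
  shows "lin_ext (lie_gen 0 v) f - lin_ext (lie_gen 0 x) f \<in> null_chains s 0"
  unfolding lin_ext_fun_diff[symmetric]
proof (rule lin_ext_mem_degree(1)[OF free_submodule_null_chains assms(2)])
  fix a
  obtain c where v: "v = (\<lambda>b. x b + (c * b - b * c))"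
    using assms(1) by (rule diff_InnE)
  show "lie_gen 0 v [a] - lie_gen 0 x [a] \<in> null_chains s 0"
    by (rule mem_by_eq[OF null_closed(3)[OF tensor_rel_null_chains[OF tensor_rel_closed(3)[OF
          tensor_add_0[of "x a" "c * a - a * c"] tensor_diff_0[of "c * a" "a * c"]]]
          null_commutator[of c a]]])
      (simp add: calc v)
qed

text \<open>Contracting homotopy for the Lie derivative along \<open>[c, \<cdot>]\<close>: on \<open>a \<otimes> b\<close> it equals the boundary of
  \<open>a \<otimes> b \<otimes> c - a \<otimes> c \<otimes> b\<close> minus \<open>[a, b] \<otimes> c\<close>. The last term is a function of the boundary of
  \<open>a \<otimes> b\<close>, so it disappears on cycles.\<close>

lemma lie_inner_1:
  assumes "v - x \<in> Inn" "f \<in> free_cycles s"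
  shows "lin_ext (lie_gen (Suc 0) v) f - lin_ext (lie_gen (Suc 0) x) f \<in> null_chains s (Suc 0)"
proof -
  obtain c where v: "v = (\<lambda>b. x b + (c * b - b * c))"
    using assms(1) by (rule diff_InnE)
  let ?r = "\<lambda>xs. gen [hd xs, c] :: ('a, 'k) free_chain"
  let ?b = "lin_ext (b_gen (Suc 0))"
  have "lin_ext (lie_gen (Suc 0) v) f - lin_ext (lie_gen (Suc 0) x) f + lin_ext ?r (?b f)
      \<in> null_chains s (Suc 0)"
    unfolding lin_ext_lin_ext lin_ext_fun_diff[symmetric] lin_ext_fun_add[symmetric]
  proof (rule lin_ext_mem_degree(2)[OF free_submodule_null_chains free_cycles_degree[OF assms(2)]])
    fix a b
    show "lie_gen (Suc 0) v [a, b] - lie_gen (Suc 0) x [a, b] + lin_ext ?r (b_gen (Suc 0) [a, b])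
        \<in> null_chains s (Suc 0)"
      by (rule mem_by_eq[OF null_closed(3)[OF tensor_rel_null_chains[OF tensor_rel_closed(3)[OF
            tensor_rel_closed(3)[OF
              tensor_add_left[of "x a" "c * a - a * c" b] tensor_diff_left[of "c * a" "a * c" b]]
            tensor_rel_closed(3)[OF
              tensor_add_right[of a "x b" "c * b - b * c"]
              tensor_diff_right[of a "c * b" "b * c"]]]]
            null_closed(4)[OF null_leibniz[of a b c] null_leibniz[of a c b]]]])
        (simp add: calc v)
  qed
  moreover have "lin_ext ?r (?b f) \<in> null_chains s (Suc 0)"
    using free_cycles_b_tensor_rel[OF assms(2)]
    by (intro tensor_rel_null_chains,
        rule lin_ext_tensor_rel_degree(1)[OF free_submodule_tensor_rel, rotated];
        unfold list.sel; intro linear_intros)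
  ultimately show ?thesis
    by (rule mem_by_eq[OF null_closed(4)]) simp
qed

text \<open>On \<open>a \<otimes> b\<close> the inner derivation \<open>[c, \<cdot>]\<close> contributes \<open>c b a - b c a\<close>, which modulo
  commutators is \<open>- c [a, b]\<close>, a function of the boundary of \<open>a \<otimes> b\<close> that vanishes on cycles.\<close>

lemma pairing_inner:
  assumes "v - x \<in> Inn" "f \<in> free_cycles s"
  shows "lin_ext (pairing_gen v) f - lin_ext (pairing_gen x) f \<in> null_chains s 0"
proof -
  obtain c where v: "v = (\<lambda>b. x b + (c * b - b * c))"
    using assms(1) by (rule diff_InnE)
  let ?l = "\<lambda>xs. gen [c * hd xs] :: ('a, 'k) free_chain"
  let ?b = "lin_ext (b_gen (Suc 0))"
  have "lin_ext (pairing_gen v) f - lin_ext (pairing_gen x) f + lin_ext ?l (?b f)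
      \<in> null_chains s 0"
    unfolding lin_ext_lin_ext lin_ext_fun_diff[symmetric] lin_ext_fun_add[symmetric]
  proof (rule lin_ext_mem_degree(2)[OF free_submodule_null_chains free_cycles_degree[OF assms(2)]])
    fix a b
    show "pairing_gen v [a, b] - pairing_gen x [a, b] + lin_ext ?l (b_gen (Suc 0) [a, b])
        \<in> null_chains s 0"
      by (rule mem_by_eq[OF null_closed(4)[OF tensor_rel_null_chains[OF tensor_rel_closed(3)[OF
            tensor_add_0[of "x b * a" "c * b * a - b * c * a"]
            tensor_diff_0[of "c * b * a" "b * c * a"]]] null_commutator[of b "c * a"]]])
        (simp add: calc v algebra_simps)
  qed
  moreover have "lin_ext ?l (?b f) \<in> null_chains s 0"
    using free_cycles_b_tensor_rel[OF assms(2)]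
    by (intro tensor_rel_null_chains,
        rule lin_ext_tensor_rel_degree(1)[OF free_submodule_tensor_rel, rotated];
        unfold list.sel; intro linear_intros)
  ultimately show ?thesis
    by (rule mem_by_eq[OF null_closed(4)]) simp
qed

lemma Lie_0_hclass:
  assumes "x \<in> Der s" "f \<in> chains_of_degree 0"
  shows "Lie s 0 (x +o Inn) (hclass s 0 f) = hclass s 0 (lin_ext (lie_gen 0 x) f)"
  unfolding Lie_def lie_gen_def[symmetric]
proof (rule UN_coset[OF subgroup_Inn])
  fix v assume v: "v - x \<in> Inn"
  note der = Der_closed(3)[OF assms(1) v]
  show "induced (boundaries s 0) (chain_map s 0 (lie_gen 0 v)) (hclass s 0 f)
      = hclass s 0 (lin_ext (lie_gen 0 x) f)"
    by (simp add: chain_map_hclass lie_tensor_rel lie_null_0 der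
        hclass_eqI[OF lie_inner_0[OF v assms(2)]])
qed

lemma Lie_1_hclass:
  assumes "x \<in> Der s" "f \<in> free_cycles s"
  shows "Lie s (Suc 0) (x +o Inn) (hclass s (Suc 0) f)
    = hclass s (Suc 0) (lin_ext (lie_gen (Suc 0) x) f)"
  unfolding Lie_def lie_gen_def[symmetric]
proof (rule UN_coset[OF subgroup_Inn])
  fix v assume v: "v - x \<in> Inn"
  note der = Der_closed(3)[OF assms(1) v]
  show "induced (boundaries s (Suc 0)) (chain_map s (Suc 0) (lie_gen (Suc 0) v))
      (hclass s (Suc 0) f) = hclass s (Suc 0) (lin_ext (lie_gen (Suc 0) x) f)"
    by (simp add: chain_map_hclass lie_tensor_rel lie_null_1 der
        hclass_eqI[OF lie_inner_1[OF v assms(2)]])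
qed

lemma pairing_hclass:
  assumes "x \<in> Der s" "f \<in> free_cycles s"
  shows "pairing s (x +o Inn) (hclass s (Suc 0) f) = hclass s 0 (lin_ext (pairing_gen x) f)"
  unfolding pairing_def pairing_gen_def[symmetric]
proof (rule UN_coset[OF subgroup_Inn])
  fix v assume v: "v - x \<in> Inn"
  note der = Der_closed(3)[OF assms(1) v]
  show "induced (boundaries s 0) (chain_map s 0 (pairing_gen v)) (hclass s (Suc 0) f)
      = hclass s 0 (lin_ext (pairing_gen x) f)"
    by (simp add: chain_map_hclass pairing_tensor_rel pairing_null der
        hclass_eqI[OF pairing_inner[OF v assms(2)]])
qed

lemma Connes_B_hclass: "Connes_B s (hclass s 0 f) = hclass s (Suc 0) (lin_ext connes_gen f)"
  unfolding Connes_B_def connes_gen_def[symmetric] One_nat_def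
  by (intro chain_map_hclass connes_tensor_rel connes_null) simp_all

lemma HH_center_mult_hclass:
  "z \<in> center \<Longrightarrow>
    HH_center_mult s (Suc 0) z (hclass s (Suc 0) f) = hclass s (Suc 0) (lin_ext (center_gen z) f)"
  unfolding HH_center_mult_def center_gen_def[symmetric]
  by (intro chain_map_hclass center_tensor_rel center_null) simp_all

section \<open>Cartan identities up to null chains\<close>

lemma lie_der_bracket:
  assumes "x \<in> Der s" "y \<in> Der s" "f \<in> chains_of_degree (Suc 0)"
  shows "lin_ext (lie_gen (Suc 0) (der_bracket x y)) f
    - (lin_ext (lie_gen (Suc 0) x) (lin_ext (lie_gen (Suc 0) y) f)
       - lin_ext (lie_gen (Suc 0) y) (lin_ext (lie_gen (Suc 0) x) f)) \<in> null_chains s (Suc 0)"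
  unfolding lin_ext_lin_ext lin_ext_fun_diff[symmetric]
proof (rule lin_ext_mem_degree(2)[OF free_submodule_null_chains assms(3)])
  fix a b
  show "lie_gen (Suc 0) (der_bracket x y) [a, b]
      - (lin_ext (lie_gen (Suc 0) x) (lie_gen (Suc 0) y [a, b])
         - lin_ext (lie_gen (Suc 0) y) (lie_gen (Suc 0) x [a, b])) \<in> null_chains s (Suc 0)"
    by (rule mem_by_eq[OF tensor_rel_null_chains[OF tensor_rel_closed(3)[OF
          tensor_diff_left[of "x (y a)" "y (x a)" b] tensor_diff_right[of a "x (y b)" "y (x b)"]]]])
      (simp add: calc der_bracket_def algebra_simps)
qed

lemma lie_pairing:
  assumes "x \<in> Der s" "y \<in> Der s" "f \<in> chains_of_degree (Suc 0)"
  shows "lin_ext (lie_gen 0 x) (lin_ext (pairing_gen y) f)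
    - lin_ext (pairing_gen (der_bracket x y)) f
    - lin_ext (pairing_gen y) (lin_ext (lie_gen (Suc 0) x) f) \<in> null_chains s 0"
  unfolding lin_ext_lin_ext lin_ext_fun_diff[symmetric]
proof (rule lin_ext_mem_degree(2)[OF free_submodule_null_chains assms(3)])
  fix a b
  show "lin_ext (lie_gen 0 x) (pairing_gen y [a, b]) - pairing_gen (der_bracket x y) [a, b]
      - lin_ext (pairing_gen y) (lie_gen (Suc 0) x [a, b]) \<in> null_chains s 0"
    by (rule mem_by_eq[OF tensor_rel_null_chains[OF tensor_rel_closed(4)[OF
          tensor_add_0[of "x (y b) * a" "y b * x a"]
          tensor_diff_0[of "x (y b) * a" "y (x b) * a"]]]])
      (simp add: calc der_bracket_def Der_simps[OF assms(1)] algebra_simps)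
qed

lemma pairing_der_bracket_swap:
  assumes "f \<in> chains_of_degree (Suc 0)"
  shows "lin_ext (pairing_gen (der_bracket x y)) f + lin_ext (pairing_gen (der_bracket y x)) f
    \<in> null_chains s 0"
  unfolding lin_ext_fun_add[symmetric]
proof (rule lin_ext_mem_degree(2)[OF free_submodule_null_chains assms])
  fix a b
  show "pairing_gen (der_bracket x y) [a, b] + pairing_gen (der_bracket y x) [a, b]
      \<in> null_chains s 0"
    by (rule mem_by_eq[OF tensor_rel_null_chains[OF tensor_rel_closed(3)[OF
          tensor_diff_0[of "x (y b) * a" "y (x b) * a"]
          tensor_diff_0[of "y (x b) * a" "x (y b) * a"]]]])
      (simp add: calc der_bracket_def algebra_simps)
qed

lemma lie_connes:
  assumes "x \<in> Der s" "h \<in> chains_of_degree 0"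
  shows "lin_ext (lie_gen (Suc 0) x) (lin_ext connes_gen h)
    - lin_ext connes_gen (lin_ext (lie_gen 0 x) h) \<in> null_chains s (Suc 0)"
  unfolding lin_ext_lin_ext lin_ext_fun_diff[symmetric]
proof (rule lin_ext_mem_degree(1)[OF free_submodule_null_chains assms(2)])
  fix a
  show "lin_ext (lie_gen (Suc 0) x) (connes_gen [a]) - lin_ext connes_gen (lie_gen 0 x [a])
      \<in> null_chains s (Suc 0)"
    by (rule mem_by_eq[OF tensor_rel_null_chains[OF tensor_rel_closed(3)[OF
          tensor_zero_left[of a] tensor_zero_right[of a]]]])
      (simp add: calc Der_simps[OF assms(1)])
qed

text \<open>The term \<open>a \<otimes> 1\<close> of \<open>B(a)\<close> is killed because \<open>x(1) = 0\<close>.\<close>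

lemma pairing_connes:
  assumes "x \<in> Der s" "h \<in> chains_of_degree 0"
  shows "lin_ext (pairing_gen x) (lin_ext connes_gen h) - lin_ext (lie_gen 0 x) h
    \<in> null_chains s 0"
  unfolding lin_ext_lin_ext lin_ext_fun_diff[symmetric]
proof (rule lin_ext_mem_degree(1)[OF free_submodule_null_chains assms(2)])
  fix a
  show "lin_ext (pairing_gen x) (connes_gen [a]) - lie_gen 0 x [a] \<in> null_chains s 0"
    by (rule mem_by_eq[OF tensor_rel_null_chains[OF tensor_zero_0]])
      (simp add: calc Der_simps[OF assms(1)])
qed

lemma lie_center:
  assumes "x \<in> Der s" "f \<in> chains_of_degree (Suc 0)"
  shows "lin_ext (lie_gen (Suc 0) x) (lin_ext (center_gen z) f)
    - lin_ext (center_gen z) (lin_ext (lie_gen (Suc 0) x) f) - lin_ext (center_gen (x z)) f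
    \<in> null_chains s (Suc 0)"
  unfolding lin_ext_lin_ext lin_ext_fun_diff[symmetric]
proof (rule lin_ext_mem_degree(2)[OF free_submodule_null_chains assms(2)])
  fix a b
  show "lin_ext (lie_gen (Suc 0) x) (center_gen z [a, b])
      - lin_ext (center_gen z) (lie_gen (Suc 0) x [a, b]) - center_gen (x z) [a, b]
      \<in> null_chains s (Suc 0)"
    by (rule mem_by_eq[OF tensor_rel_null_chains[OF tensor_add_left[of "x z * a" "z * x a" b]]])
      (simp add: calc Der_simps[OF assms(1)])
qed

text \<open>Modulo null chains, both sides send \<open>a \<otimes> b\<close> to \<open>z x(a) \<otimes> b - z x(b) \<otimes> a\<close>. On the left this uses
  \<open>null_exact\<close> for \<open>1 \<otimes> z x(b) a\<close>, on the right the boundary of \<open>z \<otimes> x(b) \<otimes> a\<close>.\<close>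

lemma lie_minus_connes_center:
  assumes "x \<in> Der s" "z \<in> center" "f \<in> chains_of_degree (Suc 0)"
  shows "lin_ext (lie_gen (Suc 0) (\<lambda>a. z * x a)) f
    - lin_ext connes_gen (lin_ext (pairing_gen (\<lambda>a. z * x a)) f)
    - (lin_ext (center_gen z) (lin_ext (lie_gen (Suc 0) x) f)
       - lin_ext (center_gen z) (lin_ext connes_gen (lin_ext (pairing_gen x) f)))
    \<in> null_chains s (Suc 0)"
  unfolding lin_ext_lin_ext lin_ext_fun_diff[symmetric]
proof (rule lin_ext_mem_degree(2)[OF free_submodule_null_chains assms(3)])
  fix a b
  have comm: "a * z = z * a"
    using assms(2) by (simp add: center_def)
  show "lie_gen (Suc 0) (\<lambda>a. z * x a) [a, b]
      - lin_ext connes_gen (pairing_gen (\<lambda>a. z * x a) [a, b])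
      - (lin_ext (center_gen z) (lie_gen (Suc 0) x [a, b])
         - lin_ext (\<lambda>xs. lin_ext (center_gen z) (connes_gen xs)) (pairing_gen x [a, b]))
      \<in> null_chains s (Suc 0)"
    by (rule mem_by_eq[OF null_closed(4)[OF
          null_closed(3)[OF null_closed(2)[OF null_exact[of "z * x b" a]]
            null_closed(2)[OF null_unit_right[of "z * x b * a"]]]
          null_closed(4)[OF null_leibniz[of z "x b" a] null_unit_right[of "z * x b * a"]]]])
      (simp add: calc mult.assoc center_left_commute[OF assms(2)] comm)
qed

section \<open>The Courant bracket\<close>

lemma E_cases:
  assumes "e \<in> E s"
  obtains x f where "x \<in> Der s" "f \<in> free_cycles s" "e = (x +o Inn, hclass s (Suc 0) f)"
  using assms by (auto simp: E_def H1_def HH_1_eq)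

lemma courant_hclass:
  assumes "x \<in> Der s" "y \<in> Der s" "f \<in> free_cycles s" "g \<in> free_cycles s"
  shows "courant s (x +o Inn, hclass s (Suc 0) f) (y +o Inn, hclass s (Suc 0) g)
    = (der_bracket x y +o Inn,
       hclass s (Suc 0) (lin_ext (lie_gen (Suc 0) x) g - lin_ext (lie_gen (Suc 0) y) f
         + lin_ext connes_gen (lin_ext (pairing_gen y) f)))"
  by (simp add: courant_def H1_bracket_coset Lie_1_hclass pairing_hclass Connes_B_hclass
      HH_minus_hclass hclass_add assms)

lemma courant_free_cycles:
  assumes "x \<in> Der s" "y \<in> Der s" "f \<in> free_cycles s" "g \<in> free_cycles s"
  shows "lin_ext (lie_gen (Suc 0) x) g - lin_ext (lie_gen (Suc 0) y) f
    + lin_ext connes_gen (lin_ext (pairing_gen y) f) \<in> free_cycles s"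
  by (intro free_submodule_closed[OF free_submodule_free_cycles] lie_free_cycles
      connes_free_cycles pairing_degree assms)

lemma form_hclass:
  assumes "x \<in> Der s" "y \<in> Der s" "f \<in> free_cycles s" "g \<in> free_cycles s"
  shows "form s (x +o Inn, hclass s (Suc 0) f) (y +o Inn, hclass s (Suc 0) g)
    = hclass s 0 (lin_ext (pairing_gen y) f + lin_ext (pairing_gen x) g)"
  by (simp add: form_def pairing_hclass hclass_add assms)

lemma E_center_mult_hclass:
  "z \<in> center \<Longrightarrow> E_center_mult s z (x +o Inn, hclass s (Suc 0) f)
    = ((\<lambda>a. z * x a) +o Inn, hclass s (Suc 0) (lin_ext (center_gen z) f))"
  by (simp add: E_center_mult_def H1_center_mult_coset HH_center_mult_hclass)

lemma anchor_courant: "anchor (courant s e1 e2) = H1_bracket (anchor e1) (anchor e2)"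
  by (simp add: anchor_def courant_def split: prod.split)

text \<open>Each side is linear in the three cycles, so the difference splits into one part for each of
  them. The part in the first cycle is the only one in which \<open>B i B\<close> occurs; it needs \<open>i\<^sub>z B = L\<^sub>z\<close>
  on degree zero.\<close>

lemma courant_jacobi:
  assumes "e1 \<in> E s" "e2 \<in> E s" "e3 \<in> E s"
  shows "courant s e1 (courant s e2 e3)
    = courant s (courant s e1 e2) e3 + courant s e2 (courant s e1 e3)"
proof -
  obtain x f where x: "x \<in> Der s" "f \<in> free_cycles s" "e1 = (x +o Inn, hclass s (Suc 0) f)"
    using assms(1) by (rule E_cases)
  obtain y g where y: "y \<in> Der s" "g \<in> free_cycles s" "e2 = (y +o Inn, hclass s (Suc 0) g)"
    using assms(2) by (rule E_cases)
  obtain z h where z: "z \<in> Der s" "h \<in> free_cycles s" "e3 = (z +o Inn, hclass s (Suc 0) h)"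
    using assms(3) by (rule E_cases)
  note der = x(1) y(1) z(1) and cyc = x(2) y(2) z(2)
  note deg = cyc[THEN free_cycles_degree]
  have jacobi: "der_bracket x (der_bracket y z)
      = der_bracket (der_bracket x y) z + der_bracket y (der_bracket x z)"
    by (simp add: fun_eq_iff der_bracket_def der[THEN Der_simps(6)])
  note K = lie_der_bracket[OF x(1) y(1) deg(3)] lie_der_bracket[OF x(1) z(1) deg(2)]
    lie_der_bracket[OF y(1) z(1) deg(1)]
    lie_connes[OF x(1) pairing_degree[OF y(2)], of z]
    connes_null[OF lie_pairing[OF x(1) z(1) deg(2)]]
    lie_connes[OF y(1) pairing_degree[OF x(2)], of z]
    connes_null[OF lie_pairing[OF y(1) z(1) deg(1)]]
    lie_connes[OF z(1) pairing_degree[OF x(2)], of y]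
    connes_null[OF pairing_connes[OF z(1) pairing_degree[OF x(2)], of y]]
  \<comment> \<open>The terms in the third cycle are settled by \<open>K(1)\<close>, those in the second by
    \<open>K(2)\<close>, \<open>K(4)\<close>, \<open>K(5)\<close>, and those in the first by the others.\<close>
  note defect = null_closed(3)[OF null_closed(3)[OF null_closed(3)[OF
        null_closed(4)[OF null_closed(4)[OF K(2) K(1)] K(3)] null_closed(3)[OF K(4) K(5)]]
        null_closed(4)[OF K(8) K(9)]] null_closed(2)[OF null_closed(3)[OF K(6) K(7)]]]
  show ?thesis
    unfolding x(3) y(3) z(3)
    by (simp add: courant_hclass courant_free_cycles der cyc Der_closed(1)
        coset_add[OF subgroup_Inn] hclass_add jacobi,
      rule hclass_eqI, rule mem_by_eq[OF defect]) (simp add: lin_ext_simps)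
qed

text \<open>The Lie derivative of the second cycle gives the anchor term. The other two terms are together
  linear over the center in the second derivation, although neither is so on its own.\<close>

lemma courant_center_mult:
  assumes "e1 \<in> E s" "e2 \<in> E s" "c \<in> center"
  shows "courant s e1 (E_center_mult s c e2)
    = E_center_mult s c (courant s e1 e2) + E_center_mult s (H1_apply (anchor e1) c) e2"
proof -
  obtain x f where x: "x \<in> Der s" "f \<in> free_cycles s" "e1 = (x +o Inn, hclass s (Suc 0) f)"
    using assms(1) by (rule E_cases)
  obtain y g where y: "y \<in> Der s" "g \<in> free_cycles s" "e2 = (y +o Inn, hclass s (Suc 0) g)"
    using assms(2) by (rule E_cases)
  note xc = Der_center[OF x(1) assms(3)] and cy = Der_closed(2)[OF y(1) assms(3)]
    and cg = center_free_cycles[OF assms(3) y(2)]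
  have bracket: "der_bracket x (\<lambda>a. c * y a) = (\<lambda>a. c * der_bracket x y a) + (\<lambda>a. x c * y a)"
    by (simp add: fun_eq_iff der_bracket_def Der_simps[OF x(1)] algebra_simps)
  note defect = null_closed(4)[OF lie_center[OF x(1) free_cycles_degree[OF y(2)], of c]
      lie_minus_connes_center[OF y(1) assms(3) free_cycles_degree[OF x(2)]]]
  show ?thesis
    unfolding x(3) y(3) anchor_def fst_conv H1_apply_coset[OF assms(3)]
    by (simp add: courant_hclass E_center_mult_hclass x y xc cy cg assms(3) bracket
        coset_add[OF subgroup_Inn] hclass_add,
      rule hclass_eqI, rule mem_by_eq[OF defect]) (simp add: lin_ext_simps)
qed

text \<open>The two Lie derivatives cancel, which leaves \<open>B\<close> applied to the pairing of the derivation
  and the cycle of \<open>e\<close>; the form is the sum of two copies of this pairing.\<close>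

lemma courant_self:
  assumes "e \<in> E s"
  shows "courant s e e + courant s e e = D s (form s e e)"
proof -
  obtain x f where x: "x \<in> Der s" "f \<in> free_cycles s" "e = (x +o Inn, hclass s (Suc 0) f)"
    using assms by (rule E_cases)
  have "der_bracket x x + der_bracket x x = 0"
    by (simp add: fun_eq_iff der_bracket_def)
  then show ?thesis
    by (simp add: x courant_hclass form_hclass D_def Connes_B_hclass hclass_add lin_ext_add
        coset_add[OF subgroup_Inn])
qed

lemma Lie_form:
  assumes "e1 \<in> E s" "e2 \<in> E s" "e3 \<in> E s"
  shows "Lie s 0 (anchor e1) (form s e2 e3)
    = form s (courant s e1 e2) e3 + form s e2 (courant s e1 e3)"
proof -
  obtain x f where x: "x \<in> Der s" "f \<in> free_cycles s" "e1 = (x +o Inn, hclass s (Suc 0) f)"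
    using assms(1) by (rule E_cases)
  obtain y g where y: "y \<in> Der s" "g \<in> free_cycles s" "e2 = (y +o Inn, hclass s (Suc 0) g)"
    using assms(2) by (rule E_cases)
  obtain z h where z: "z \<in> Der s" "h \<in> free_cycles s" "e3 = (z +o Inn, hclass s (Suc 0) h)"
    using assms(3) by (rule E_cases)
  note der = x(1) y(1) z(1) and cyc = x(2) y(2) z(2)
  note deg = cyc[THEN free_cycles_degree]
  note K = lie_pairing[OF x(1) z(1) deg(2)] lie_pairing[OF x(1) y(1) deg(3)]
    lie_pairing[OF z(1) y(1) deg(1)] lie_pairing[OF y(1) z(1) deg(1)]
    pairing_connes[OF z(1) pairing_degree[OF x(2)], of y]
    pairing_connes[OF y(1) pairing_degree[OF x(2)], of z]
    pairing_der_bracket_swap[OF deg(1), of y z]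
  \<comment> \<open>\<open>K(1)\<close> and \<open>K(2)\<close> settle the terms in the second and third cycle. In the first cycle,
    \<open>K(5)\<close> and \<open>K(6)\<close> turn the Connes terms into Lie derivatives of pairings, which \<open>K(3)\<close>
    and \<open>K(4)\<close> expand; by \<open>K(7)\<close> the two remaining brackets cancel.\<close>
  note defect = null_closed(4)[OF null_closed(3)[OF K(1) K(2)] null_closed(3)[OF
        null_closed(3)[OF K(3) K(4)] null_closed(3)[OF null_closed(3)[OF K(5) K(6)] K(7)]]]
  show ?thesis
    unfolding x(3) y(3) z(3) anchor_def fst_conv
    by (simp add: courant_hclass courant_free_cycles form_hclass Lie_0_hclass der cyc
        Der_closed(1) free_submodule_closed(3)[OF free_submodule_chains_of_degree]
        pairing_degree hclass_add,
      rule hclass_eqI, rule mem_by_eq[OF defect]) (simp add: lin_ext_simps)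
qed

lemma D_in_E: "\<alpha> \<in> HH s 0 \<Longrightarrow> D s \<alpha> \<in> E s"
proof -
  assume "\<alpha> \<in> HH s 0"
  then obtain h where h: "h \<in> chains_of_degree 0" "\<alpha> = hclass s 0 h"
    by (auto simp: HH_0_eq)
  have "(0 :: 'a \<Rightarrow> 'a) \<in> Der s"
    by (simp add: Der_def scale_zero)
  then have "Inn \<in> H1 s"
    using set_zero_plus[of "Inn :: ('a \<Rightarrow> 'a) set"] unfolding H1_def
    by (metis (mono_tags, lifting) mem_Collect_eq)
  then show ?thesis
    using connes_free_cycles[OF h(1)] by (simp add: D_def E_def h(2) Connes_B_hclass HH_1_eq)
qed

lemma D_add: "\<alpha> \<in> HH s 0 \<Longrightarrow> \<beta> \<in> HH s 0 \<Longrightarrow> D s (\<alpha> + \<beta>) = D s \<alpha> + D s \<beta>"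
  using coset_add[OF subgroup_Inn, of 0 0]
  by (auto simp: HH_0_eq D_def hclass_add Connes_B_hclass lin_ext_add)

lemma D_scale: "\<alpha> \<in> HH s 0 \<Longrightarrow> D s (HH_scale s 0 r \<alpha>) = E_scale s r (D s \<alpha>)"
  by (auto simp: HH_0_eq D_def E_scale_def HH_scale_hclass Connes_B_hclass lin_ext_scale H1_scale_Inn)

end

theorem proposition3p2:
  fixes s :: "'k::{comm_ring,comm_monoid_mult} \<Rightarrow> 'a::{ring,monoid_mult} \<Rightarrow> 'a"
  assumes "k_algebra s"
  shows
    "(\<forall>e1\<in>E s. \<forall>e2\<in>E s. \<forall>e3\<in>E s. \<forall>z\<in>center.
        courant s e1 (courant s e2 e3)
          = courant s (courant s e1 e2) e3 + courant s e2 (courant s e1 e3)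
      \<and> anchor (courant s e1 e2) = H1_bracket (anchor e1) (anchor e2)
      \<and> courant s e1 (E_center_mult s z e2)
          = E_center_mult s z (courant s e1 e2)
            + E_center_mult s (H1_apply (anchor e1) z) e2
      \<and> courant s e1 e1 + courant s e1 e1 = D s (form s e1 e1)
      \<and> Lie s 0 (anchor e1) (form s e2 e3)
          = form s (courant s e1 e2) e3 + form s e2 (courant s e1 e3))
     \<and> (\<forall>\<alpha>\<in>HH s 0. D s \<alpha> \<in> E s)
     \<and> (\<forall>\<alpha>\<in>HH s 0. \<forall>\<beta>\<in>HH s 0. D s (\<alpha> + \<beta>) = D s \<alpha> + D s \<beta>)
     \<and> (\<forall>r. \<forall>\<alpha>\<in>HH s 0. D s (HH_scale s 0 r \<alpha>) = E_scale s r (D s \<alpha>))"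
proof -
  interpret k_algebra s
    by fact
  show ?thesis
    by (intro conjI ballI allI courant_jacobi anchor_courant courant_center_mult courant_self
        Lie_form D_in_E D_add D_scale)
qed

end
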